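(* Let $\mathcal{S}(n,p,d)$ be the maximum number of simultaneously satisfiable equations in an instance of random XORSAT with parameters $n,p,d$, and let $d^*(p)$ be the satisfiability threshold. For $d>d^*(p)$ sufficiently large, with high probability as $n\to\infty$, $$\frac{\mathcal{S}(n,p,d)}{n}=\frac{d}{2p}+\frac{\mathsf{P}_p}{2}\sqrt{\frac dp}+o_d(\sqrt d).$$
   Context: Random XORSAT. Let $p\ge2$ be a fixed integer and let $x_1,\dots,x_n$ be Boolean variables. Each $p$-subset $\{i_1,\dots,i_p\}$ of $\{1,\dots,n\}$ is included independently with probability $d(p-1)!/n^{p-1}$; each included subset $a$ gives an equation $x_{i_1}\oplus\cdots\oplus x_{i_p}=b_a$ ($\oplus$ is addition mod 2) with $b_a\in\{0,1\}$ i.i.d. Bernoulli$(1/2)$. The threshold $d^*(p)$, independent of $n$, is such that for $d<d^*(p)$ a random instance is satisfiable (all equations can be satisfied simultaneously) with high probability, while for $d>d^*(p)$ it is unsatisfiable with high probability. The constant $\mathsf{P}_p$. Let $\{G_{i_1,\dots,i_p}:1\le i_1,\dots,i_p\le n\}$ be i.i.d. $\mathcal{N}(0,1)$. For $\beta>0$ and $h\in\mathbb{R}$ let, for $\underline\sigma\in\{-1,+1\}^n$, $$H_n(\underline\sigma)=\beta\sum_{i_1,\dots,i_p=1}^n\frac{G_{i_1,\dots,i_p}}{n^{(p-1)/2}}\sigma_{i_1}\cdots\sigma_{i_p}+\beta h\sum_{i=1}^n\sigma_i.$$ Let $F_p(\beta,h)=\lim_{n\to\infty}\frac1n\log\sum_{\underline\sigma\in\{\pm1\}^n}\exp(H_n(\underline\sigma))$,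 which exists with probability $1$ and is deterministic. Then $\mathsf{P}_p=\lim_{\beta\to\infty}\frac{F_p(\beta,0)}{\beta}$ (this limit exists). Conventions. "With high probability" means with probability tending to $1$ as $n\to\infty$. A sequence of random variables $Z_n$ (depending on $d$) is $o_d(\sqrt d)$ with high probability if there is a deterministic function $g(d)$ with $g(d)/\sqrt d\to0$ as $d\to\infty$ such that $\mathbb{P}[|Z_n|\le g(d)]\to1$ as $n\to\infty$. *)

theory Defs
  imports "HOL-Probability.Probability" "HOL-Library.Z2"
begin

section \<open>Random XORSAT\<close>

text \<open>
  An instance is a map \<open>\<omega>\<close> on the \<open>p\<close>-subsets of \<open>{1..n}\<close>: \<open>\<omega> a = None\<close> means that \<open>a\<close> is not
  included, and \<open>\<omega> a = Some b\<close> that the equation with variable set \<open>a\<close> and right-hand side \<open>b\<close>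
  is. The field \<^typ>\<open>bit\<close> has two elements, so its addition is \<open>\<oplus>\<close>.
\<close>

type_synonym xor_instance = "nat set \<Rightarrow> bit option"

definition psubsets :: "nat \<Rightarrow> nat \<Rightarrow> nat set set" where
  "psubsets n p = {a. a \<subseteq> {1..n} \<and> card a = p}"

definition equation_pmf :: "real \<Rightarrow> bit option pmf" where
  "equation_pmf q =
     bind_pmf (bernoulli_pmf q)
       (\<lambda>included. if included then map_pmf (\<lambda>b. Some (of_bool b)) (bernoulli_pmf (1/2))
                   else return_pmf None)"

text \<open>
  \<^const>\<open>bernoulli_pmf\<close> truncates its parameter to \<open>[0, 1]\<close>; for \<open>p \<ge> 2\<close> and \<open>d > 0\<close> this affects
  only finitely many \<open>n\<close>.
\<close>

definition random_xorsat :: "nat \<Rightarrow> nat \<Rightarrow> real \<Rightarrow> xor_instance pmf" where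
  "random_xorsat n p d =
     Pi_pmf (psubsets n p) None (\<lambda>_. equation_pmf (d * fact (p - 1) / real n ^ (p - 1)))"

definition assignments :: "nat \<Rightarrow> (nat \<Rightarrow> bit) set" where
  "assignments n = {1..n} \<rightarrow>\<^sub>E UNIV"

definition satisfied_eqs :: "nat \<Rightarrow> nat \<Rightarrow> xor_instance \<Rightarrow> (nat \<Rightarrow> bit) \<Rightarrow> nat set set" where
  "satisfied_eqs n p \<omega> x = {a \<in> psubsets n p. \<omega> a = Some (\<Sum>i\<in>a. x i)}"

definition max_sat :: "nat \<Rightarrow> nat \<Rightarrow> xor_instance \<Rightarrow> nat" where
  "max_sat n p \<omega> = Max ((\<lambda>x. card (satisfied_eqs n p \<omega> x)) ` assignments n)"

definition satisfiable :: "nat \<Rightarrow> nat \<Rightarrow> xor_instance \<Rightarrow> bool" where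
  "satisfiable n p \<omega> \<longleftrightarrow>
     (\<exists>x\<in>assignments n. \<forall>a\<in>psubsets n p. \<forall>b. \<omega> a = Some b \<longrightarrow> (\<Sum>i\<in>a. x i) = b)"

definition sat_whp :: "nat \<Rightarrow> real \<Rightarrow> bool" where
  "sat_whp p d \<longleftrightarrow>
     (\<lambda>n. measure_pmf.prob (random_xorsat n p d) {\<omega>. satisfiable n p \<omega>}) \<longlonglongrightarrow> 1"

definition unsat_whp :: "nat \<Rightarrow> real \<Rightarrow> bool" where
  "unsat_whp p d \<longleftrightarrow>
     (\<lambda>n. measure_pmf.prob (random_xorsat n p d) {\<omega>. \<not> satisfiable n p \<omega>}) \<longlonglongrightarrow> 1"

text \<open>
  The threshold \<open>d\<^sup>*(p)\<close>. Whenever a number separates the two regimes it equals \<open>sat_threshold p\<close>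
  (lemma \<open>sat_threshold_eqI\<close>). For \<open>p = 2\<close> no number does: below the point where the giant
  component of the random graph appears, satisfiability has probability bounded away
  from both 0 and 1. The infimum of the unsatisfiable regime is meaningful there too.
\<close>

definition sat_threshold :: "nat \<Rightarrow> real" where
  "sat_threshold p = Inf {d. 0 < d \<and> unsat_whp p d}"

lemma not_sat_whp_and_unsat_whp:
  assumes "sat_whp p d" and "unsat_whp p d"
  shows False
proof -
  have eq: "measure_pmf.prob (random_xorsat n p d) {\<omega>. \<not> satisfiable n p \<omega>} =
        1 - measure_pmf.prob (random_xorsat n p d) {\<omega>. satisfiable n p \<omega>}" for n
    using measure_pmf.prob_compl[of "{\<omega>. satisfiable n p \<omega>}" "random_xorsat n p d"]
    by (simp add: Compl_eq_Diff_UNIV[symmetric] Collect_neg_eq)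
  have "(\<lambda>n. measure_pmf.prob (random_xorsat n p d) {\<omega>. \<not> satisfiable n p \<omega>}) \<longlonglongrightarrow> 1 - 1"
    unfolding eq by (intro tendsto_diff tendsto_const assms(1)[unfolded sat_whp_def])
  with assms(2) show False
    unfolding unsat_whp_def using LIMSEQ_unique by fastforce
qed

lemma sat_threshold_eqI:
  assumes "0 \<le> ds"
    and below: "\<And>d. 0 < d \<Longrightarrow> d < ds \<Longrightarrow> sat_whp p d"
    and above: "\<And>d. ds < d \<Longrightarrow> unsat_whp p d"
  shows "sat_threshold p = ds"
  unfolding sat_threshold_def
proof (rule cInf_eq_non_empty)
  show "{d. 0 < d \<and> unsat_whp p d} \<noteq> {}"
    using above[of "ds + 1"] \<open>0 \<le> ds\<close> by (auto intro!: exI[of _ "ds + 1"])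
next
  fix d assume "d \<in> {d. 0 < d \<and> unsat_whp p d}"
  then show "ds \<le> d"
    using below not_sat_whp_and_unsat_whp by (metis mem_Collect_eq not_le)
next
  fix y assume y: "\<And>d. d \<in> {d. 0 < d \<and> unsat_whp p d} \<Longrightarrow> y \<le> d"
  show "y \<le> ds"
  proof (rule dense_ge)
    fix d assume "ds < d"
    then show "y \<le> d" using y[of d] above[of d] \<open>0 \<le> ds\<close> by auto
  qed
qed


section \<open>The \<open>p\<close>-spin Hamiltonian\<close>

text \<open>
  The couplings form a single infinite i.i.d. array, indexed by all lists \<open>[i\<^sub>1, \<dots>, i\<^sub>p]\<close>; the
  system of size \<open>n\<close> uses those with entries in \<open>{1..n}\<close>. Repeated entries are allowed.
\<close>

definition disorder :: "nat \<Rightarrow> (nat list \<Rightarrow> real) measure" where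
  "disorder p = PiM {is. length is = p} (\<lambda>_. std_normal_distribution)"

definition tuples :: "nat \<Rightarrow> nat \<Rightarrow> nat list set" where
  "tuples n p = {is. length is = p \<and> set is \<subseteq> {1..n}}"

definition spins :: "nat \<Rightarrow> (nat \<Rightarrow> real) set" where
  "spins n = {1..n} \<rightarrow>\<^sub>E {-1, 1}"

definition hamiltonian ::
    "nat \<Rightarrow> nat \<Rightarrow> real \<Rightarrow> real \<Rightarrow> (nat list \<Rightarrow> real) \<Rightarrow> (nat \<Rightarrow> real) \<Rightarrow> real" where
  "hamiltonian n p \<beta> h G \<sigma> =
     \<beta> * (\<Sum>is\<in>tuples n p. G is / real n powr ((real p - 1) / 2) * (\<Prod>i\<leftarrow>is. \<sigma> i))
     + \<beta> * h * (\<Sum>i=1..n. \<sigma> i)"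

definition is_free_energy :: "nat \<Rightarrow> real \<Rightarrow> real \<Rightarrow> real \<Rightarrow> bool" where
  "is_free_energy p \<beta> h c \<longleftrightarrow>
     (AE G in disorder p.
        (\<lambda>n. 1 / real n * ln (\<Sum>\<sigma>\<in>spins n. exp (hamiltonian n p \<beta> h G \<sigma>))) \<longlonglongrightarrow> c)"

text \<open>
  \<open>is_free_energy p \<beta> h c\<close> says that the limit defining \<open>F\<^sub>p(\<beta>, h)\<close> exists almost surely and is the
  constant \<open>c\<close>; there is at most one such \<open>c\<close>.
\<close>

lemma is_free_energy_unique:
  assumes "is_free_energy p \<beta> h c" and "is_free_energy p \<beta> h c'"
  shows "c = c'"
proof -
  interpret prob_space "disorder p"
    unfolding disorder_def by (intro prob_space_PiM prob_space_normal_density) simp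
  have "AE G in disorder p. c = c'"
    using assms[unfolded is_free_energy_def] by eventually_elim (rule LIMSEQ_unique)
  then show ?thesis by simp
qed

end

theory Submission
  imports Defs "HOL-Real_Asymp.Real_Asymp"
begin

text \<open>
  Fix an assignment and let \<open>\<sigma>\<close> be the corresponding spin vector. An equation with variable set \<open>a\<close>
  contributes \<open>\<xi>\<^sub>a \<Prod>i\<in>a. \<sigma> i\<close> to (satisfied minus violated), where \<open>\<xi>\<^sub>a\<close> is \<open>1\<close>, \<open>- 1\<close> or, if \<open>a\<close> is not
  included, \<open>0\<close>. So twice the maximal number of satisfied equations is the number of equations,
  about \<open>n d / p\<close>, plus the maximum over \<open>\<sigma>\<close> of a multilinear form whose coefficients \<open>\<xi>\<^sub>a\<close> are
  independent, symmetric and very sparse. The claim is that for large \<open>d\<close> this maximum is as if the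
  \<open>\<xi>\<^sub>a\<close> were Gaussian with the same variance, and then it is a ground state energy of the
  \<open>p\<close>-spin model.

  The maximum is replaced by the free energy \<open>L = (1 / n) ln (\<Sum>\<sigma>. exp (s \<dots>))\<close>, which differs from
  \<open>s\<close> times the maximum per variable by at most \<open>ln 2\<close> (lemma \<open>xor_partition_bounds\<close>). With
  \<open>s = \<beta> sqrt (p / d)\<close> the variance of \<open>s \<xi>\<^sub>a\<close> is exactly that of the sum of the \<open>p!\<close> coefficients in the
  Hamiltonian that belong to the orderings of \<open>a\<close>. The coefficients are exchanged one at a time
  (Lindeberg's method, lemma \<open>lindeberg_exchange\<close>): first and second moments agree, so a smooth
  function of \<open>L\<close> changes only by third-order terms. In the limit \<open>n \<longrightarrow> \<infinity>\<close> the Gaussian ones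
  vanish and the sparse ones add up to a multiple of \<open>\<beta>\<^sup>3 / sqrt d\<close>
  (lemmas \<open>gaussian_xor_exchange\<close>, \<open>exchange_error_tendsto\<close>). Couplings whose index tuple has a
  repeated entry have no counterpart in XORSAT; they are exchanged for \<open>0\<close>, at a second-order cost,
  which is affordable because there are only \<open>o(n ^ p)\<close> such tuples.

  The smooth function is \<open>bump (L - F)\<close> with \<open>bump x = 1 / (1 + x\<^sup>2)\<close>. It is bounded, so almost sure
  convergence of the Gaussian free energy to \<open>F\<close> already gives convergence of its expectation to \<open>1\<close>,
  with no integrability to check; and it is at most \<open>1 / 2\<close> where \<open>\<bar>L - F\<bar> \<ge> 1\<close>. Hence
  \<open>\<bar>L - F\<bar> \<le> 1\<close> holds with probability more than \<open>1 / 2\<close> once \<open>\<beta>\<^sup>3 / sqrt d\<close> is small, not with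
  probability tending to \<open>1\<close>, as the exchange error does not vanish for fixed \<open>d\<close> and \<open>\<beta>\<close>. The gap is closed by
  concentration: adding one equation changes the optimum by at most \<open>1\<close>, and the expected number of
  equations is linear in \<open>n\<close>, so by an Efron--Stein bound (lemma \<open>efron_stein_default\<close>) the optimum has
  variance linear in \<open>n\<close>. An event of probability more than \<open>1 / 2\<close> then locates its mean, and the mean
  locates the optimum with high probability (lemma \<open>max_sat_whp\<close>). Errors of order \<open>1\<close> in \<open>L\<close> become
  errors of order \<open>1 / s\<close> in the number of satisfied equations per variable, so any \<open>\<beta>\<close> that tends to
  infinity with \<open>\<beta>\<^sup>3 = o(sqrt d)\<close> gives the theorem; the choice is \<open>\<beta> = d powr (1 / 12)\<close>.
\<close>

section \<open>A bounded smooth function of a free energy\<close>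

definition bump :: "real \<Rightarrow> real" where "bump x = 1 / (1 + x\<^sup>2)"

text \<open>The first three derivatives of \<^const>\<open>bump\<close>, in a form that shows them to be bounded.\<close>
definition bump1 :: "real \<Rightarrow> real" where "bump1 x = - 2 * x * bump x ^ 2"
definition bump2 :: "real \<Rightarrow> real" where "bump2 x = - 2 * bump x ^ 2 + 8 * x\<^sup>2 * bump x ^ 3"
definition bump3 :: "real \<Rightarrow> real" where "bump3 x = 24 * x * bump x ^ 3 - 48 * x ^ 3 * bump x ^ 4"

lemma bump_pos: "0 < bump x" and bump_le_1: "bump x \<le> 1"
  by (auto simp: bump_def add_pos_nonneg divide_le_eq_1)

lemma abs_bump [simp]: "\<bar>bump x\<bar> = bump x"
  using bump_pos[of x] by simp

lemma bump_le_half: "1 \<le> \<bar>x\<bar> \<Longrightarrow> bump x \<le> 1 / 2"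
  using abs_le_square_iff[of 1 x] by (simp add: bump_def field_simps)

lemma abs_mult_bump_le: "\<bar>x * bump x\<bar> \<le> 1 / 2"
proof -
  have "2 * \<bar>x\<bar> \<le> 1 + x\<^sup>2"
    using zero_le_power2[of "\<bar>x\<bar> - 1"] by (simp add: power2_diff)
  then show ?thesis
    by (simp add: bump_def abs_mult field_simps add_pos_nonneg)
qed

lemma bump_deriv [derivative_intros]:
  assumes "(f has_real_derivative f') (at t)"
  shows "((\<lambda>t. bump (f t)) has_real_derivative bump1 (f t) * f') (at t)"
proof -
  have "1 + (f t)\<^sup>2 > 0" by (simp add: add_pos_nonneg)
  then show ?thesis
    unfolding bump_def bump1_def
    by (auto intro!: derivative_eq_intros assms simp: power2_eq_square)
qed

lemma bump1_deriv [derivative_intros]: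
  assumes "(f has_real_derivative f') (at t)"
  shows "((\<lambda>t. bump1 (f t)) has_real_derivative bump2 (f t) * f') (at t)"
  unfolding bump1_def[abs_def]
  by (auto intro!: derivative_eq_intros assms
      simp: bump1_def bump2_def power2_eq_square power3_eq_cube algebra_simps)

lemma bump2_deriv [derivative_intros]:
  assumes "(f has_real_derivative f') (at t)"
  shows "((\<lambda>t. bump2 (f t)) has_real_derivative bump3 (f t) * f') (at t)"
  unfolding bump2_def[abs_def]
  by (auto intro!: derivative_eq_intros assms
      simp: bump1_def bump3_def power2_eq_square power3_eq_cube power4_eq_xxxx algebra_simps)

lemma abs_bump1_le: "\<bar>bump1 x\<bar> \<le> 1"
proof -
  have "\<bar>bump1 x\<bar> = 2 * \<bar>x * bump x\<bar> * bump x"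
    by (simp add: bump1_def abs_mult power2_eq_square)
  also have "\<dots> \<le> 2 * (1 / 2) * 1"
    by (intro mult_mono abs_mult_bump_le bump_le_1) (auto simp: bump_pos less_imp_le)
  finally show ?thesis by simp
qed

lemma abs_bump2_le: "\<bar>bump2 x\<bar> \<le> 4"
proof -
  have "\<bar>bump2 x\<bar> \<le> 2 * bump x ^ 2 + 8 * (\<bar>x * bump x\<bar> ^ 2 * bump x)"
    unfolding bump2_def
    by (rule order_trans[OF abs_triangle_ineq])
       (simp add: abs_mult power_mult_distrib power_numeral_reduce mult_ac)
  also have "\<dots> \<le> 2 * 1 ^ 2 + 8 * ((1/2) ^ 2 * 1)"
    by (intro add_mono mult_mono power_mono abs_mult_bump_le bump_le_1)
       (auto simp: bump_pos less_imp_le)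
  finally show ?thesis by (simp add: power2_eq_square)
qed

lemma abs_bump3_le: "\<bar>bump3 x\<bar> \<le> 18"
proof -
  have "\<bar>bump3 x\<bar> \<le> 24 * (\<bar>x * bump x\<bar> * bump x ^ 2) +
      48 * (\<bar>x * bump x\<bar> ^ 3 * bump x)"
    unfolding bump3_def
    by (rule order_trans[OF abs_triangle_ineq4])
       (simp add: abs_mult power_abs power_mult_distrib power_numeral_reduce mult_ac)
  also have "\<dots> \<le> 24 * (1/2 * 1 ^ 2) + 48 * ((1/2) ^ 3 * 1)"
    by (intro add_mono mult_mono power_mono abs_mult_bump_le bump_le_1)
       (auto simp: bump_pos less_imp_le)
  finally show ?thesis by (simp add: power_numeral_reduce)
qed

text \<open>
  A partition function depends on each single coefficient \<open>t\<close> as \<open>A exp t + B exp (- t)\<close>: the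
  configurations split according to the sign with which \<open>t\<close> enters. The derivative \<open>m\<close> of its
  logarithm satisfies \<open>\<bar>m\<bar> \<le> 1\<close> and \<open>m' = 1 - m\<^sup>2\<close>, whatever \<open>A\<close> and \<open>B\<close> are, so the derivatives of the
  logarithm are bounded uniformly in all other coefficients. The factor \<open>1 / n\<close> in the bounds is what
  makes about \<open>n\<close> sparse exchanges affordable.
\<close>
lemma bump_log_partition_taylor:
  fixes A B c :: real and n :: nat
  assumes "0 \<le> A" "0 \<le> B" "0 < A + B" "1 \<le> n"
  defines "h \<equiv> (\<lambda>t. bump (ln (A * exp t + B * exp (- t)) / real n - c))"
  shows "\<exists>a b. \<bar>b\<bar> \<le> 3 / real n \<and>
    (\<forall>t. \<bar>h t - (h 0 + a * t + b * t\<^sup>2)\<bar> \<le> 6 / real n * \<bar>t\<bar> ^ 3)"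
proof -
  define Z where "Z = (\<lambda>t. A * exp t + B * exp (- t))"
  define m where "m = (\<lambda>t. (A * exp t - B * exp (- t)) / Z t)"
  define y where "y = (\<lambda>t. ln (Z t) / real n - c)"
  have n: "1 \<le> real n" "0 < real n" using assms(4) by auto
  have Z_pos: "0 < Z t" for t
    using assms(1-3) unfolding Z_def
    by (cases "A = 0") (auto intro!: add_pos_nonneg)
  have Z_deriv: "(Z has_real_derivative A * exp t - B * exp (- t)) (at t)" for t
    unfolding Z_def by (auto intro!: derivative_eq_intros)
  have m_abs: "\<bar>m t\<bar> \<le> 1" for t
    using assms(1,2) Z_pos[of t] unfolding m_def
    by (simp add: abs_le_iff Z_def)
  have m_sq: "0 \<le> 1 - (m t)\<^sup>2" "1 - (m t)\<^sup>2 \<le> 1" for t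
    using m_abs[of t] by (auto simp: abs_square_le_1)
  have m_deriv: "(m has_real_derivative 1 - (m t)\<^sup>2) (at t)" for t
  proof -
    have "(m has_real_derivative
        (Z t * Z t - (A * exp t - B * exp (- t)) * (A * exp t - B * exp (- t))) / (Z t * Z t)) (at t)"
      unfolding m_def using Z_pos[of t]
      by (auto intro!: derivative_eq_intros Z_deriv) (simp add: Z_def algebra_simps)
    also have "(Z t * Z t - (A * exp t - B * exp (- t)) * (A * exp t - B * exp (- t))) / (Z t * Z t)
        = 1 - (m t)\<^sup>2"
      using Z_pos[of t] by (simp add: m_def power2_eq_square divide_simps)
    finally show ?thesis .
  qed
  have y_deriv: "(y has_real_derivative m t / real n) (at t)" for t
    unfolding y_def m_def using Z_pos[of t] n
    by (auto intro!: derivative_eq_intros Z_deriv)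
  \<comment> \<open>The derivatives of \<open>h\<close> of order \<open>0\<close> to \<open>3\<close>, by the chain rule with \<open>y' = m / n\<close> and \<open>m' = 1 - m\<^sup>2\<close>.\<close>
  define D :: "nat \<Rightarrow> real \<Rightarrow> real" where "D = (\<lambda>j t. if j = 0 then bump (y t)
     else if j = 1 then bump1 (y t) * (m t / n)
     else if j = 2 then bump2 (y t) * (m t / n) ^ 2 + bump1 (y t) * ((1 - (m t)\<^sup>2) / n)
     else bump3 (y t) * (m t / n) ^ 3 + 3 * (bump2 (y t) * (m t / n) * ((1 - (m t)\<^sup>2) / n))
        + bump1 (y t) * (- 2 * m t * (1 - (m t)\<^sup>2) / n))"
  have D_deriv: "(D j has_real_derivative D (Suc j) t) (at t)" if "j < 3" for j t
  proof -
    from that consider "j = 0" | "j = 1" | "j = 2" by linarith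
    then show ?thesis
    proof cases
      case 1 then show ?thesis
        unfolding D_def by (auto intro!: derivative_eq_intros y_deriv)
    next
      case 2 then show ?thesis
        unfolding D_def using n
        by (auto intro!: derivative_eq_intros y_deriv m_deriv simp: power2_eq_square field_simps)
    next
      case 3
      have "((\<lambda>t. bump2 (y t) * (m t / n) ^ 2 + bump1 (y t) * ((1 - (m t)\<^sup>2) / n))
         has_real_derivative (bump3 (y t) * (m t / n) ^ 3 + 3 * (bump2 (y t) * (m t / n) * ((1 - (m t)\<^sup>2) / n))
        + bump1 (y t) * (- 2 * m t * (1 - (m t)\<^sup>2) / n))) (at t)"
        using n
        by (auto intro!: derivative_eq_intros y_deriv m_deriv simp: divide_simps)
           (auto simp: power2_eq_square power3_eq_cube algebra_simps)
      with 3 show ?thesis unfolding D_def by simp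
    qed
  qed
  have D2: "\<bar>D 2 0\<bar> \<le> 5 / n"
  proof -
    have "\<bar>D 2 0\<bar> \<le> \<bar>bump2 (y 0)\<bar> * (\<bar>m 0\<bar> * \<bar>m 0\<bar>) / n * (1 / n) + \<bar>bump1 (y 0)\<bar> * (1 - (m 0)\<^sup>2) / n"
      unfolding D_def using m_sq[of 0] n
      by (simp add: abs_mult power2_eq_square) (rule order_trans[OF abs_triangle_ineq], simp add: abs_mult)
    also have "\<dots> \<le> 4 * (1 * 1) / n * 1 + 1 * 1 / n"
      using m_sq[of 0] n
      by (intro add_mono mult_mono divide_right_mono abs_bump2_le abs_bump1_le m_abs) auto
    finally show ?thesis using n by (simp add: field_simps)
  qed
  have D3: "\<bar>D 3 t\<bar> \<le> 32 / n" for t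
  proof -
    define X where "X = bump3 (y t) * (m t / n) ^ 3"
    define Y where "Y = 3 * (bump2 (y t) * (m t / n) * ((1 - (m t)\<^sup>2) / n))"
    define W where "W = bump1 (y t) * (- 2 * m t * (1 - (m t)\<^sup>2) / n)"
    have "D 3 t = X + Y + W"
      unfolding D_def X_def Y_def W_def by simp
    then have "\<bar>D 3 t\<bar> \<le> \<bar>X\<bar> + \<bar>Y\<bar> + \<bar>W\<bar>"
      by linarith
    moreover have "\<bar>X\<bar> = \<bar>bump3 (y t)\<bar> * (\<bar>m t\<bar> * \<bar>m t\<bar> * \<bar>m t\<bar>) / n * (1 / n * (1 / n))"
      using n by (simp add: X_def power3_eq_cube abs_mult field_simps)
    moreover have "\<bar>Y\<bar> = 3 * (\<bar>bump2 (y t)\<bar> * \<bar>m t\<bar> * (1 - (m t)\<^sup>2)) / n * (1 / n)"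
      using n m_sq[of t] by (simp add: Y_def abs_mult)
    moreover have "\<bar>W\<bar> = \<bar>bump1 (y t)\<bar> * (2 * \<bar>m t\<bar> * (1 - (m t)\<^sup>2)) / n"
      using n m_sq[of t] by (simp add: W_def abs_mult)
    ultimately have "\<bar>D 3 t\<bar> \<le> \<bar>bump3 (y t)\<bar> * (\<bar>m t\<bar> * \<bar>m t\<bar> * \<bar>m t\<bar>) / n * (1 / n * (1 / n))
      + 3 * (\<bar>bump2 (y t)\<bar> * \<bar>m t\<bar> * (1 - (m t)\<^sup>2)) / n * (1 / n)
      + \<bar>bump1 (y t)\<bar> * (2 * \<bar>m t\<bar> * (1 - (m t)\<^sup>2)) / n"
      by simp
    also have "\<dots> \<le> 18 * (1 * 1 * 1) / n * (1 * 1) + 3 * (4 * 1 * 1) / n * 1 + 1 * (2 * 1 * 1) / n"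
      using m_sq[of t] n
      by (intro add_mono mult_mono divide_right_mono abs_bump2_le abs_bump1_le abs_bump3_le m_abs)
        auto
    finally show ?thesis using n by (simp add: field_simps)
  qed
  have h: "h = D 0" by (auto simp: h_def D_def y_def Z_def)
  have "\<bar>h t - (h 0 + D 1 0 * t + D 2 0 / 2 * t\<^sup>2)\<bar> \<le> 6 / n * \<bar>t\<bar> ^ 3" for t
  proof -
    obtain u where "h t = (\<Sum>j<3. (D j 0 / fact j) * t ^ j) + (D 3 u / fact 3) * t ^ 3"
      using Maclaurin_bi_le[of D h 3 t] D_deriv h by auto
    then have eq: "h t - (h 0 + D 1 0 * t + D 2 0 / 2 * t\<^sup>2) = D 3 u / 6 * t ^ 3"
      by (simp add: eval_nat_numeral h)
    have "\<bar>D 3 u / 6 * t ^ 3\<bar> = \<bar>D 3 u\<bar> / 6 * \<bar>t\<bar> ^ 3"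
      by (simp add: abs_mult power_abs)
    also have "\<dots> \<le> 32 / n / 6 * \<bar>t\<bar> ^ 3"
      by (intro mult_right_mono divide_right_mono D3) auto
    also have "\<dots> \<le> 6 / n * \<bar>t\<bar> ^ 3"
      using n by (intro mult_right_mono) (auto simp: field_simps)
    finally show ?thesis unfolding eq .
  qed
  moreover have "\<bar>D 2 0 / 2\<bar> \<le> 3 / n" using D2 n by (simp add: field_simps)
  ultimately show ?thesis by blast
qed

section \<open>Products of sparse distributions\<close>

lemma finite_set_Pi_pmf:
  assumes "finite A" "\<And>x. x \<in> A \<Longrightarrow> finite (set_pmf (Q x))"
  shows "finite (set_pmf (Pi_pmf A dflt Q))"
  using assms by (simp add: set_Pi_pmf finite_PiE_dflt)

lemma expectation_finite_pmf:
  fixes f :: "'a \<Rightarrow> real"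
  shows "finite (set_pmf p) \<Longrightarrow> measure_pmf.expectation p f = (\<Sum>a\<in>set_pmf p. pmf p a * f a)"
  by (subst integral_measure_pmf[of "set_pmf p"]) auto

lemma expectation_Pi_pmf_insert:
  fixes h :: "('a \<Rightarrow> 'b) \<Rightarrow> real"
  assumes "finite A" "x \<notin> A" "\<And>y. y \<in> insert x A \<Longrightarrow> finite (set_pmf (Q y))"
  shows "measure_pmf.expectation (Pi_pmf (insert x A) dflt Q) h =
    measure_pmf.expectation (Pi_pmf A dflt Q)
      (\<lambda>w. measure_pmf.expectation (Q x) (\<lambda>b. h (w(x := b))))"
proof -
  have fin: "finite (set_pmf (Pi_pmf A dflt Q))" "finite (set_pmf (Q x))"
    using assms by (auto intro: finite_set_Pi_pmf)
  have "Pi_pmf (insert x A) dflt Q =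
      do {w \<leftarrow> Pi_pmf A dflt Q; map_pmf (\<lambda>b. w(x := b)) (Q x)}"
    using assms(1,2) by (simp add: Pi_pmf_insert' bind_commute_pmf[of "Q x"] map_pmf_def)
  then show ?thesis
    using fin by (simp add: pmf_expectation_bind[of "set_pmf (Pi_pmf A dflt Q)"]
        expectation_finite_pmf[of "Pi_pmf A dflt Q"])
qed

text \<open>
  The variance of a function of independent coordinates is at most the sum of the expected
  conditional variances given all coordinates but one. Such a conditional variance is in turn at most
  the mean squared distance to the value at the default, and this vanishes unless the coordinate is
  different from the default, which has probability at most \<open>q\<close>. So sparse coordinates contribute
  little, even if there are many of them.
\<close>
lemma efron_stein_default:
  fixes f :: "('a \<Rightarrow> 'b) \<Rightarrow> real"
  assumes "finite A" "\<And>x. x \<in> A \<Longrightarrow> finite (set_pmf (Q x))"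
    and "\<And>x. x \<in> A \<Longrightarrow> measure_pmf.prob (Q x) (- {dflt}) \<le> q"
    and "\<And>x w. x \<in> A \<Longrightarrow> \<bar>f w - f (w(x := dflt))\<bar> \<le> C"
  shows "measure_pmf.variance (Pi_pmf A dflt Q) f \<le> real (card A) * q * C\<^sup>2"
  using assms
proof (induction A arbitrary: f rule: finite_induct)
  case empty
  show ?case by simp
next
  case (insert x A)
  define P where "P = Pi_pmf A dflt Q"
  define g where "g = (\<lambda>w. measure_pmf.expectation (Q x) (\<lambda>b. f (w(x := b))))"
  have finQ: "finite (set_pmf (Q x))" using insert.prems by auto
  have finP: "finite (set_pmf P)"
    unfolding P_def using insert by (intro finite_set_Pi_pmf) auto
  have intQ [simp]: "integrable (measure_pmf (Q x)) h" for h :: "'b \<Rightarrow> real"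
    using finQ by (rule integrable_measure_pmf_finite)
  have intP [simp]: "integrable (measure_pmf P) h" for h :: "('a \<Rightarrow> 'b) \<Rightarrow> real"
    using finP by (rule integrable_measure_pmf_finite)
  have E: "measure_pmf.expectation (Pi_pmf (insert x A) dflt Q) h =
      measure_pmf.expectation P (\<lambda>w. measure_pmf.expectation (Q x) (\<lambda>b. h (w(x := b))))"
    for h :: "_ \<Rightarrow> real"
    unfolding P_def using insert by (intro expectation_Pi_pmf_insert) auto
  define M where "M = measure_pmf.expectation P g"
  have mean: "measure_pmf.expectation (Pi_pmf (insert x A) dflt Q) f = M"
    by (simp add: E M_def g_def)
  have coord: "measure_pmf.expectation (Q x) (\<lambda>b. (f (w(x := b)) - M)\<^sup>2)
      \<le> q * C\<^sup>2 + (g w - M)\<^sup>2" for w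
  proof -
    define F where "F = (\<lambda>b. f (w(x := b)))"
    have EF: "measure_pmf.expectation (Q x) F = g w" by (simp add: F_def g_def)
    have split: "measure_pmf.expectation (Q x) (\<lambda>b. (F b - a)\<^sup>2) =
        measure_pmf.expectation (Q x) (\<lambda>b. (F b)\<^sup>2) - 2 * a * g w + a\<^sup>2" for a
      by (simp add: power2_diff EF algebra_simps)
    \<comment> \<open>The mean square about \<open>M\<close> and the one about the default value both differ from the variance by a square.\<close>
    have e1: "measure_pmf.expectation (Q x) (\<lambda>b. (F b - M)\<^sup>2) =
      measure_pmf.expectation (Q x) (\<lambda>b. (F b - F dflt)\<^sup>2) - (F dflt - g w)\<^sup>2 + (g w - M)\<^sup>2"
      unfolding split by (simp add: power2_eq_square algebra_simps)
    have "measure_pmf.expectation (Q x) (\<lambda>b. (F b - F dflt)\<^sup>2) \<le>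
        measure_pmf.expectation (Q x) (\<lambda>b. C\<^sup>2 * indicator (- {dflt}) b)"
    proof (intro integral_mono intQ)
      fix b
      have "\<bar>F b - F dflt\<bar> \<le> C"
        using insert.prems(3)[of x "w(x := b)"] unfolding F_def by (simp only: fun_upd_upd insertI1)
      then have "(F b - F dflt)\<^sup>2 \<le> C\<^sup>2"
        by (metis abs_ge_zero power2_abs power_mono)
      then show "(F b - F dflt)\<^sup>2 \<le> C\<^sup>2 * indicator (- {dflt}) b"
        by (auto split: split_indicator)
    qed
    also have "\<dots> \<le> C\<^sup>2 * q"
      using insert.prems(2)[of x] by (auto intro: mult_left_mono)
    finally have e2: "measure_pmf.expectation (Q x) (\<lambda>b. (F b - F dflt)\<^sup>2) \<le> q * C\<^sup>2"
      by (simp add: mult.commute)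
    show ?thesis
      using e1 e2 zero_le_power2[of "F dflt - g w"] unfolding F_def by linarith
  qed
  have g_lip: "\<bar>g w - g (w(y := dflt))\<bar> \<le> C" if "y \<in> A" for y w
  proof -
    have "y \<noteq> x" using that insert.hyps by auto
    have "\<bar>g w - g (w(y := dflt))\<bar> =
      \<bar>measure_pmf.expectation (Q x) (\<lambda>b. f (w(x := b)) - f (w(y := dflt, x := b)))\<bar>"
      by (simp add: g_def)
    also have "\<dots> \<le> measure_pmf.expectation (Q x) (\<lambda>b. \<bar>f (w(x := b)) - f (w(y := dflt, x := b))\<bar>)"
      by (rule integral_abs_bound)
    also have "\<dots> \<le> measure_pmf.expectation (Q x) (\<lambda>b. C)"
    proof (intro integral_mono intQ)
      fix b
      show "\<bar>f (w(x := b)) - f (w(y := dflt, x := b))\<bar> \<le> C"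
        unfolding fun_upd_twist[OF \<open>y \<noteq> x\<close>]
        using that by (intro insert.prems(3)) simp
    qed
    finally show ?thesis by simp
  qed
  have "measure_pmf.variance (Pi_pmf (insert x A) dflt Q) f =
      measure_pmf.expectation P (\<lambda>w. measure_pmf.expectation (Q x) (\<lambda>b. (f (w(x := b)) - M)\<^sup>2))"
    unfolding mean by (rule E)
  also have "\<dots> \<le> measure_pmf.expectation P (\<lambda>w. q * C\<^sup>2 + (g w - M)\<^sup>2)"
    by (intro integral_mono intP coord)
  also have "\<dots> = q * C\<^sup>2 + measure_pmf.variance P g"
    by (simp add: M_def)
  also have "measure_pmf.variance P g \<le> real (card A) * q * C\<^sup>2"
    unfolding P_def
  proof (rule insert.IH)
    show "\<bar>g w - g (w(y := dflt))\<bar> \<le> C" if "y \<in> A" for y w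
      using that by (rule g_lip)
  qed (use insert.prems in auto)
  finally show ?case using insert.hyps by (simp add: algebra_simps)
qed

text \<open>
  Lindeberg's replacement of one independent family by another. In the induction the coordinate \<open>k\<close>
  of \<open>f\<close> is averaged over its new law; the averaged function satisfies the same one-coordinate
  bounds as \<open>f\<close>, and the price of the averaging is \<open>e k\<close>. The continuous side is a product measure
  and the discrete side a product of finitely supported distributions, so that the latter is
  directly the law of a random instance.
\<close>
lemma lindeberg_exchange:
  fixes \<mu> :: "'k \<Rightarrow> real measure" and Q :: "'k \<Rightarrow> 'b pmf" and u :: "'k \<Rightarrow> 'b \<Rightarrow> real"
    and f :: "('k \<Rightarrow> real) \<Rightarrow> real"
  assumes "finite K" and \<mu>: "\<And>k. prob_space (\<mu> k)" "\<And>k. sets (\<mu> k) = sets borel"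
    and "\<And>k. k \<in> K \<Longrightarrow> finite (set_pmf (Q k))"
    and "f \<in> borel_measurable (PiM K (\<lambda>_. borel))"
    and "\<And>x. \<bar>f x\<bar> \<le> C"
    and "\<And>k x. k \<in> K \<Longrightarrow> x \<in> extensional K \<Longrightarrow>
      \<bar>(\<integral>t. f (x(k := t)) \<partial>\<mu> k) - measure_pmf.expectation (Q k) (\<lambda>b. f (x(k := u k b)))\<bar> \<le> e k"
  shows "\<bar>(\<integral>x. f x \<partial>PiM K \<mu>) -
      measure_pmf.expectation (Pi_pmf K dflt Q) (\<lambda>w. f (\<lambda>k\<in>K. u k (w k)))\<bar> \<le> (\<Sum>k\<in>K. e k)"
  using assms(1,4-)
proof (induction K arbitrary: f rule: finite_induct)
  case empty
  show ?case
    by (simp add: PiM_empty lebesgue_integral_count_space_finite restrict_def)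
next
  case (insert k K)
  have psf: "product_sigma_finite \<mu>"
    unfolding product_sigma_finite_def using \<mu>(1) prob_space_imp_sigma_finite by auto
  note [measurable_cong] = \<mu>(2)
  interpret K: prob_space "PiM K \<mu>" by (rule prob_space_PiM[OF \<mu>(1)])
  interpret kK: prob_space "PiM (insert k K) \<mu>" by (rule prob_space_PiM[OF \<mu>(1)])
  interpret \<mu>k: prob_space "\<mu> k" by (rule \<mu>(1))
  have [measurable]: "f \<in> borel_measurable (PiM (insert k K) (\<lambda>_. borel))" by (rule insert.prems(2))
  have sets_PiM_borel: "sets (PiM J \<mu>) = sets (PiM J (\<lambda>_. borel))" for J
    by (rule sets_PiM_cong) (auto simp: \<mu>(2))
  have f_meas [measurable]: "f \<in> borel_measurable (PiM (insert k K) \<mu>)"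
    using insert.prems(2) measurable_cong_sets[OF sets_PiM_borel refl] by blast
  define G where "G = (\<lambda>x. measure_pmf.expectation (Q k) (\<lambda>b. f (x(k := u k b))))"
  have finQ: "finite (set_pmf (Q k))" using insert.prems by auto
  have G_sum: "G x = (\<Sum>b\<in>set_pmf (Q k). pmf (Q k) b * f (x(k := u k b)))" for x
    unfolding G_def by (rule expectation_finite_pmf[OF finQ])
  have upd: "(\<lambda>x. x(k := c)) \<in> measurable (PiM K (\<lambda>_. borel)) (PiM (insert k K) (\<lambda>_. borel))"
    for c :: real
    by (rule measurable_fun_upd[where J = K]) auto
  have G_meas0: "G \<in> borel_measurable (PiM K (\<lambda>_. borel))"
    unfolding G_sum[abs_def]
    by (intro borel_measurable_sum borel_measurable_times borel_measurable_const
        measurable_compose[OF upd insert.prems(2)])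
  then have G_meas [measurable]: "G \<in> borel_measurable (PiM K \<mu>)"
    using measurable_cong_sets[OF sets_PiM_borel refl] by blast
  have G_bound: "\<bar>G x\<bar> \<le> C" for x
  proof -
    have "\<bar>G x\<bar> \<le> measure_pmf.expectation (Q k) (\<lambda>b. \<bar>f (x(k := u k b))\<bar>)"
      unfolding G_def by (rule integral_abs_bound)
    also have "\<dots> \<le> measure_pmf.expectation (Q k) (\<lambda>b. C)"
      by (intro integral_mono integrable_measure_pmf_finite finQ insert.prems(3))
    finally show ?thesis by simp
  qed
  define I where "I = (\<lambda>x. \<integral>t. f (x(k := t)) \<partial>\<mu> k)"
  have [measurable]: "(\<lambda>(x, t). f (x(k := t))) \<in> borel_measurable (PiM K \<mu> \<Otimes>\<^sub>M \<mu> k)"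
    using measurable_compose[OF measurable_add_dim f_meas] by (simp add: case_prod_unfold)
  have I_meas [measurable]: "I \<in> borel_measurable (PiM K \<mu>)"
    unfolding I_def by measurable
  have I_bound: "\<bar>I x\<bar> \<le> C" if "x \<in> space (PiM K \<mu>)" for x
  proof -
    have "(\<lambda>t. f (x(k := t))) \<in> borel_measurable (\<mu> k)"
      using that by measurable
    then have "integrable (\<mu> k) (\<lambda>t. f (x(k := t)))"
      by (intro \<mu>k.integrable_const_bound[where B = C]) (auto simp: insert.prems(3))
    then have "(\<integral>t. \<bar>f (x(k := t))\<bar> \<partial>\<mu> k) \<le> (\<integral>t. C \<partial>\<mu> k)"
      by (intro integral_mono) (auto simp: insert.prems(3))
    moreover have "\<bar>I x\<bar> \<le> (\<integral>t. \<bar>f (x(k := t))\<bar> \<partial>\<mu> k)"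
      unfolding I_def by (rule integral_abs_bound)
    ultimately show ?thesis by (simp add: \<mu>k.prob_space)
  qed
  have int_f: "integrable (PiM (insert k K) \<mu>) f"
    by (rule kK.integrable_const_bound[where B = C]) (auto simp: insert.prems(3))
  have int_G: "integrable (PiM K \<mu>) G"
    by (rule K.integrable_const_bound[where B = C]) (auto simp: G_bound)
  have int_I: "integrable (PiM K \<mu>) I"
    by (rule K.integrable_const_bound[where B = C]) (auto simp: I_bound)
  have fst_step: "\<bar>(\<integral>x. f x \<partial>PiM (insert k K) \<mu>) - (\<integral>x. G x \<partial>PiM K \<mu>)\<bar> \<le> e k"
  proof -
    have "(\<integral>x. f x \<partial>PiM (insert k K) \<mu>) = (\<integral>x. I x \<partial>PiM K \<mu>)"
      unfolding I_def by (rule product_sigma_finite.product_integral_insert[OF psf insert.hyps int_f])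
    then have "\<bar>(\<integral>x. f x \<partial>PiM (insert k K) \<mu>) - (\<integral>x. G x \<partial>PiM K \<mu>)\<bar> =
        \<bar>\<integral>x. I x - G x \<partial>PiM K \<mu>\<bar>"
      using int_G int_I by simp
    also have "\<dots> \<le> (\<integral>x. \<bar>I x - G x\<bar> \<partial>PiM K \<mu>)"
      by (rule integral_abs_bound)
    also have "\<dots> \<le> (\<integral>x. e k \<partial>PiM K \<mu>)"
    proof (intro integral_mono)
      fix x assume "x \<in> space (PiM K \<mu>)"
      then have "x(k := 0) \<in> extensional (insert k K)"
        by (auto simp: space_PiM PiE_def extensional_def)
      from insert.prems(4)[OF insertI1 this] show "\<bar>I x - G x\<bar> \<le> e k"
        by (simp only: I_def G_def fun_upd_upd)
    qed (use int_G int_I in auto)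
    finally show ?thesis by (simp add: K.prob_space)
  qed
  have snd_step: "\<bar>(\<integral>x. G x \<partial>PiM K \<mu>) -
      measure_pmf.expectation (Pi_pmf K dflt Q) (\<lambda>w. G (\<lambda>j\<in>K. u j (w j)))\<bar> \<le> (\<Sum>j\<in>K. e j)"
  proof (rule insert.IH)
    fix j and x :: "'k \<Rightarrow> real"
    assume j: "j \<in> K" and x: "x \<in> extensional K"
    then have "j \<noteq> k" using insert.hyps by auto
    interpret \<mu>j: prob_space "\<mu> j" by (rule \<mu>(1))
    have finQj: "finite (set_pmf (Q j))" using insert.prems(1) j by auto
    have twist: "x(j := t, k := c) = (x(k := c))(j := t)" for t c
      using \<open>j \<noteq> k\<close> by (rule fun_upd_twist)
    have ext: "x(k := c) \<in> extensional (insert k K)" for c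
      using x by (auto simp: extensional_def)
    have int_slice: "integrable (\<mu> j) (\<lambda>t. f ((x(k := c))(j := t)))" for c
    proof (rule \<mu>j.integrable_const_bound[where B = C])
      have "(\<lambda>t. (x(k := c))(j := t)) \<in> borel \<rightarrow>\<^sub>M PiM (insert k K) (\<lambda>_. borel)"
        by (rule measurable_fun_upd[where J = "insert k K"])
           (use j ext[of c] in \<open>auto simp: space_PiM PiE_def\<close>)
      from measurable_compose[OF this insert.prems(2)]
      show "(\<lambda>t. f ((x(k := c))(j := t))) \<in> borel_measurable (\<mu> j)"
        by (simp only: measurable_cong_sets[OF \<mu>(2) refl])
    qed (auto simp: insert.prems(3))
    have "(\<integral>t. G (x(j := t)) \<partial>\<mu> j) =
        measure_pmf.expectation (Q k) (\<lambda>c. \<integral>t. f ((x(k := u k c))(j := t)) \<partial>\<mu> j)"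
      unfolding G_sum twist by (simp add: int_slice expectation_finite_pmf[OF finQ])
    moreover have "measure_pmf.expectation (Q j) (\<lambda>b. G (x(j := u j b))) =
        measure_pmf.expectation (Q k)
          (\<lambda>c. measure_pmf.expectation (Q j) (\<lambda>b. f ((x(k := u k c))(j := u j b))))"
      unfolding G_sum twist expectation_finite_pmf[OF finQ] expectation_finite_pmf[OF finQj]
        sum_distrib_left
      by (subst sum.swap) (simp add: mult_ac)
    ultimately have "\<bar>(\<integral>t. G (x(j := t)) \<partial>\<mu> j) -
          measure_pmf.expectation (Q j) (\<lambda>b. G (x(j := u j b)))\<bar> =
        \<bar>measure_pmf.expectation (Q k) (\<lambda>c. (\<integral>t. f ((x(k := u k c))(j := t)) \<partial>\<mu> j) -
          measure_pmf.expectation (Q j) (\<lambda>b. f ((x(k := u k c))(j := u j b))))\<bar>"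
      using finQ by (simp add: integrable_measure_pmf_finite)
    also have "\<dots> \<le> measure_pmf.expectation (Q k) (\<lambda>c. \<bar>(\<integral>t. f ((x(k := u k c))(j := t)) \<partial>\<mu> j) -
          measure_pmf.expectation (Q j) (\<lambda>b. f ((x(k := u k c))(j := u j b)))\<bar>)"
      by (rule integral_abs_bound)
    also have "\<dots> \<le> measure_pmf.expectation (Q k) (\<lambda>c. e j)"
      by (intro integral_mono integrable_measure_pmf_finite finQ insert.prems(4) ext insertI2 j)
    finally show "\<bar>(\<integral>t. G (x(j := t)) \<partial>\<mu> j) - measure_pmf.expectation (Q j) (\<lambda>b. G (x(j := u j b)))\<bar> \<le> e j"
      by simp
  qed (use insert.prems G_meas0 G_bound in auto)
  have "(\<lambda>w b. f (\<lambda>j\<in>insert k K. u j ((w(k := b)) j))) =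
      (\<lambda>w b. f ((\<lambda>j\<in>K. u j (w j))(k := u k b)))"
    using insert.hyps by (intro ext arg_cong[of _ _ f]) auto
  then have "measure_pmf.expectation (Pi_pmf (insert k K) dflt Q) (\<lambda>w. f (\<lambda>j\<in>insert k K. u j (w j))) =
      measure_pmf.expectation (Pi_pmf K dflt Q) (\<lambda>w. G (\<lambda>j\<in>K. u j (w j)))"
    using insert unfolding G_def by (subst expectation_Pi_pmf_insert) (auto simp: fun_eq_iff)
  moreover have "(\<Sum>j\<in>insert k K. e j) = e k + (\<Sum>j\<in>K. e j)"
    using insert.hyps by simp
  ultimately show ?case
    using fst_step snd_step by linarith
qed

section \<open>Sums of Gaussian variables\<close>

lemma indep_vars_PiM_components:
  assumes "\<And>i. i \<in> I \<Longrightarrow> prob_space (M i)" "I \<noteq> {}"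
  shows "prob_space.indep_vars (PiM I M) M (\<lambda>i x. x i) I"
proof -
  interpret prob_space "PiM I M" using assms(1) by (rule prob_space_PiM)
  have "distr (PiM I M) (PiM I M) (\<lambda>x. \<lambda>i\<in>I. x i) = distr (PiM I M) (PiM I M) (\<lambda>x. x)"
    by (intro distr_cong) (auto simp: space_PiM PiE_def extensional_restrict)
  also have "\<dots> = PiM I M" by simp
  also have "\<dots> = PiM I (\<lambda>i. distr (PiM I M) (M i) (\<lambda>x. x i))"
    using assms(1) by (intro PiM_cong refl distr_PiM_component[symmetric])
  finally show ?thesis
    using assms(2) by (subst indep_vars_iff_distr_eq_PiM') auto
qed

text \<open>
  Sums of i.i.d. Gaussians over disjoint blocks of indices are again independent Gaussians. This
  turns the couplings, which are indexed by ordered tuples, into one coefficient per set of variables.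
\<close>
lemma distr_disjoint_gaussian_sums:
  fixes B :: "'k \<Rightarrow> 'i set" and c :: real
  assumes "K \<noteq> {}" "0 < c"
    and "\<And>k. k \<in> K \<Longrightarrow> B k \<subseteq> I" "\<And>k. k \<in> K \<Longrightarrow> finite (B k)" "\<And>k. k \<in> K \<Longrightarrow> B k \<noteq> {}"
    and "disjoint_family_on B K"
  shows "distr (PiM I (\<lambda>_. std_normal_distribution)) (PiM K (\<lambda>_. borel)) (\<lambda>G. \<lambda>k\<in>K. \<Sum>i\<in>B k. c * G i) =
    PiM K (\<lambda>k. density lborel (normal_density 0 (c * sqrt (real (card (B k))))))"
proof -
  define M where "M = PiM I (\<lambda>_. std_normal_distribution)"
  have prob: "prob_space std_normal_distribution"
    by (rule prob_space_normal_density) simp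
  interpret prob_space M
    unfolding M_def by (intro prob_space_PiM prob)
  have "I \<noteq> {}" using assms(1,3,5) by blast
  then have coords: "indep_vars (\<lambda>_. std_normal_distribution) (\<lambda>i G. G i) I"
    unfolding M_def by (intro indep_vars_PiM_components prob)
  then have scaled: "indep_vars (\<lambda>_. borel) (\<lambda>i G. c * G i) I"
    by (rule indep_vars_compose2[where Y = "\<lambda>_ t. c * t"]) simp
  have coord_dist: "distributed M lborel (\<lambda>G. c * G i) (normal_density 0 c)" if "i \<in> I" for i
  proof -
    have "distr M lborel (\<lambda>G. G i) = distr M std_normal_distribution (\<lambda>G. G i)"
      by (rule distr_cong) auto
    also have "\<dots> = std_normal_distribution"
      unfolding M_def using that prob by (intro distr_PiM_component)
    finally have "distributed M lborel (\<lambda>G. G i) std_normal_density"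
      using that unfolding distributed_def M_def by simp
    from normal_density_affine[OF this, of c 0] show ?thesis
      using \<open>0 < c\<close> by simp
  qed
  have "indep_vars (\<lambda>k. PiM (B k) (\<lambda>_. borel)) (\<lambda>k G. \<lambda>i\<in>B k. c * G i) K"
    by (rule indep_vars_restrict[OF scaled]) (use assms in auto)
  then have "indep_vars (\<lambda>_. borel) (\<lambda>k G. \<Sum>i\<in>B k. (\<lambda>i\<in>B k. c * G i) i) K"
    by (rule indep_vars_compose2[where Y = "\<lambda>k x. \<Sum>i\<in>B k. x i"])
       (auto intro!: borel_measurable_sum measurable_component_singleton)
  then have blocks: "indep_vars (\<lambda>_. borel) (\<lambda>k G. \<Sum>i\<in>B k. c * G i) K"
    by (simp cong: sum.cong)
  then have rv: "(\<lambda>G. \<Sum>i\<in>B k. c * G i) \<in> borel_measurable M" if "k \<in> K" for k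
    using that by (auto simp: indep_vars_def)
  have "distr M (PiM K (\<lambda>_. borel)) (\<lambda>G. \<lambda>k\<in>K. \<Sum>i\<in>B k. c * G i) =
      PiM K (\<lambda>k. distr M borel (\<lambda>G. \<Sum>i\<in>B k. c * G i))"
    by (rule indep_vars_iff_distr_eq_PiM'[THEN iffD1, OF assms(1) rv blocks])
  also have "\<dots> = PiM K (\<lambda>k. density lborel (normal_density 0 (c * sqrt (real (card (B k))))))"
  proof (intro PiM_cong refl)
    fix k assume k: "k \<in> K"
    have "distributed M lborel (\<lambda>G. \<Sum>i\<in>B k. c * G i)
        (normal_density (\<Sum>i\<in>B k. 0) (sqrt (\<Sum>i\<in>B k. c\<^sup>2)))"
      using assms(3)[OF k] \<open>0 < c\<close>
      by (intro sum_indep_normal assms k indep_vars_subset[OF scaled] coord_dist) auto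
    moreover have "sqrt (\<Sum>i\<in>B k. c\<^sup>2) = c * sqrt (real (card (B k)))"
      using \<open>0 < c\<close> by (simp add: real_sqrt_mult mult.commute)
    ultimately have "distr M lborel (\<lambda>G. \<Sum>i\<in>B k. c * G i) =
        density lborel (normal_density 0 (c * sqrt (real (card (B k)))))"
      by (simp add: distributed_def)
    moreover have "distr M lborel (\<lambda>G. \<Sum>i\<in>B k. c * G i) = distr M borel (\<lambda>G. \<Sum>i\<in>B k. c * G i)"
      by (rule distr_cong) auto
    ultimately show "distr M borel (\<lambda>G. \<Sum>i\<in>B k. c * G i) =
        density lborel (normal_density 0 (c * sqrt (real (card (B k)))))"
      by simp
  qed
  finally show ?thesis unfolding M_def .
qed

text \<open>
  The constant \<open>2\<close> comes from the absolute third moment \<open>2 \<tau>\<^sup>3 sqrt (2 / \<pi>)\<close> of a centred Gaussian.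
\<close>
lemma normal_expectation_third_order:
  fixes h :: "real \<Rightarrow> real"
  assumes "0 < \<tau>" "h \<in> borel_measurable borel" "\<And>t. \<bar>h t\<bar> \<le> B" "0 \<le> C"
    and taylor: "\<And>t. \<bar>h t - (h0 + a * t + b * t\<^sup>2)\<bar> \<le> C * \<bar>t\<bar> ^ 3"
  shows "\<bar>(\<integral>t. h t \<partial>density lborel (normal_density 0 \<tau>)) - (h0 + b * \<tau>\<^sup>2)\<bar> \<le> 2 * C * \<tau> ^ 3"
proof -
  define \<nu> where "\<nu> = density lborel (normal_density 0 \<tau>)"
  interpret prob_space \<nu>
    unfolding \<nu>_def by (rule prob_space_normal_density[OF assms(1)])
  have sets_\<nu> [measurable_cong]: "sets \<nu> = sets borel" by (simp add: \<nu>_def)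
  note [measurable] = assms(2)
  have has: "has_bochner_integral \<nu> g x"
    if "has_bochner_integral lborel (\<lambda>t. normal_density 0 \<tau> t * g t) x" "g \<in> borel_measurable borel"
    for g :: "real \<Rightarrow> real" and x
    using that unfolding \<nu>_def has_bochner_integral_iff
    by (simp add: integrable_density integral_density)
  have m1: "has_bochner_integral \<nu> (\<lambda>t. t) 0"
    using has[OF normal_moment_odd[OF assms(1), of 0 0, simplified]] by simp
  have m2: "has_bochner_integral \<nu> (\<lambda>t. t\<^sup>2) (\<tau>\<^sup>2)"
    using has[OF normal_moment_even[OF assms(1), of 0 1, simplified]] by (simp add: numeral_2_eq_2)
  have m3: "has_bochner_integral \<nu> (\<lambda>t. \<bar>t\<bar> ^ 3) (2 * \<tau> ^ 3 * sqrt (2 / pi))"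
    using has[OF normal_moment_abs_odd[OF assms(1), of 0 1, simplified]]
    by (simp add: numeral_3_eq_3)
  have int_h: "integrable \<nu> h"
    by (rule integrable_const_bound[where B = B]) (auto simp: assms(3))
  have poly: "has_bochner_integral \<nu> (\<lambda>t. h0 + a * t + b * t\<^sup>2) (h0 + a * 0 + b * \<tau>\<^sup>2)"
    by (intro has_bochner_integral_add has_bochner_integral_mult_right m1 m2)
       (simp add: has_bochner_integral_iff prob_space)
  have "\<bar>(\<integral>t. h t \<partial>\<nu>) - (h0 + b * \<tau>\<^sup>2)\<bar> = \<bar>\<integral>t. h t - (h0 + a * t + b * t\<^sup>2) \<partial>\<nu>\<bar>"
    using int_h poly by (simp add: has_bochner_integral_iff)
  also have "\<dots> \<le> (\<integral>t. \<bar>h t - (h0 + a * t + b * t\<^sup>2)\<bar> \<partial>\<nu>)"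
    by (rule integral_abs_bound)
  also have "\<dots> \<le> (\<integral>t. C * \<bar>t\<bar> ^ 3 \<partial>\<nu>)"
    using int_h poly m3 by (intro integral_mono taylor) (auto simp: has_bochner_integral_iff)
  also have "\<dots> = 2 * C * \<tau> ^ 3 * sqrt (2 / pi)"
    using m3 by (simp add: has_bochner_integral_iff)
  also have "\<dots> \<le> 2 * C * \<tau> ^ 3 * 1"
    using assms(1,4) pi_ge_two by (intro mult_left_mono) auto
  finally show ?thesis by (simp add: \<nu>_def)
qed

section \<open>Blocks of couplings\<close>

definition repeated_tuples :: "nat \<Rightarrow> nat \<Rightarrow> nat list set" where
  "repeated_tuples n p = {is \<in> tuples n p. \<not> distinct is}"

text \<open>
  The couplings are grouped into blocks on which the spin product is the same: all orderings of a
  \<open>p\<close>-subset form one block, and each tuple with a repeated entry is a block on its own. The left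
  summand indexes the blocks that correspond to possible equations.
\<close>
definition block_index :: "nat \<Rightarrow> nat \<Rightarrow> (nat set + nat list) set" where
  "block_index n p = psubsets n p <+> repeated_tuples n p"

definition block :: "nat set + nat list \<Rightarrow> nat list set" where
  "block = case_sum permutations_of_set (\<lambda>is. {is})"

definition block_spin :: "(nat \<Rightarrow> real) \<Rightarrow> nat set + nat list \<Rightarrow> real" where
  "block_spin \<sigma> = case_sum (\<lambda>a. \<Prod>i\<in>a. \<sigma> i) (\<lambda>is. \<Prod>i\<leftarrow>is. \<sigma> i)"

text \<open>
  Both free energies are values of this function: at Gaussian \<open>x\<close> it is the partition function of the
  \<open>p\<close>-spin model (by \<open>hamiltonian_eq_blocks\<close>), at the scaled signs of a random instance the one of
  XORSAT (by \<open>xor_block_partition\<close>).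
\<close>
definition block_partition :: "nat \<Rightarrow> nat \<Rightarrow> (nat set + nat list \<Rightarrow> real) \<Rightarrow> real" where
  "block_partition n p x =
     (\<Sum>\<sigma>\<in>spins n. exp (\<Sum>k\<in>block_index n p. x k * block_spin \<sigma> k))"

text \<open>
  The coefficient \<open>\<xi>\<^sub>a\<close> of an equation: right-hand side \<open>0\<close> asks for spin product \<open>1\<close>, right-hand side \<open>1\<close>
  for spin product \<open>- 1\<close>.
\<close>
definition eq_sign :: "bit option \<Rightarrow> real" where
  "eq_sign e = (case e of None \<Rightarrow> 0 | Some b \<Rightarrow> if b = 0 then 1 else - 1)"

definition xor_partition :: "nat \<Rightarrow> nat \<Rightarrow> real \<Rightarrow> xor_instance \<Rightarrow> real" where
  "xor_partition n p s w =
     (\<Sum>\<sigma>\<in>spins n. exp (s * (\<Sum>a\<in>psubsets n p. eq_sign (w a) * (\<Prod>i\<in>a. \<sigma> i))))"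

lemma finite_psubsets [simp]: "finite (psubsets n p)"
  unfolding psubsets_def by (rule finite_subset[of _ "Pow {1..n}"]) auto

lemma card_psubsets: "card (psubsets n p) = n choose p"
  using n_subsets[of "{1..n}" p] by (simp add: psubsets_def)

lemma finite_tuples [simp]: "finite (tuples n p)"
  using finite_lists_length_eq[of "{1..n}" p] by (simp add: tuples_def conj_commute)

lemma card_tuples: "card (tuples n p) = n ^ p"
  using card_lists_length_eq[of "{1..n}" p] by (simp add: tuples_def conj_commute)

lemma finite_repeated_tuples [simp]: "finite (repeated_tuples n p)"
  by (simp add: repeated_tuples_def)

lemma finite_block_index [simp]: "finite (block_index n p)"
  by (simp add: block_index_def)

lemma finite_spins [simp]: "finite (spins n)"
  by (simp add: spins_def finite_PiE)

lemma finite_psubset: "a \<in> psubsets n p \<Longrightarrow> finite a"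
  unfolding psubsets_def using finite_subset[of a "{1..n}"] by simp

lemma spins_nonempty [simp]: "spins n \<noteq> {}"
  by (simp add: spins_def PiE_eq_empty_iff)

lemma UN_blocks: "(\<Union>k\<in>block_index n p. block k) = tuples n p"
  by (auto simp: block_index_def block_def repeated_tuples_def permutations_of_set_def
      psubsets_def tuples_def distinct_card Plus_def)

lemma disjoint_blocks: "disjoint_family_on block (block_index n p)"
  by (auto simp: disjoint_family_on_def block_index_def block_def repeated_tuples_def
      permutations_of_set_def Plus_def)

lemma finite_block [simp]: "finite (block k)"
  by (auto simp: block_def split: sum.split)

lemma block_nonempty: "k \<in> block_index n p \<Longrightarrow> block k \<noteq> {}"
  by (auto simp: block_def block_index_def finite_psubset)

lemma card_block: "a \<in> psubsets n p \<Longrightarrow> card (block (Inl a)) = fact p" "card (block (Inr is)) = 1"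
  by (auto simp: block_def finite_psubset) (simp add: psubsets_def)

text \<open>
  Counting all tuples block by block avoids a separate estimate for the repeated ones.
\<close>
lemma card_repeated_tuples: "real (card (repeated_tuples n p)) = real n ^ p - fact p * real (n choose p)"
proof -
  have "card (tuples n p) = (\<Sum>k\<in>block_index n p. card (block k))"
    unfolding UN_blocks[symmetric] using disjoint_blocks
    by (intro card_UN_disjoint) (auto simp: disjoint_family_on_def)
  also have "\<dots> = fact p * card (psubsets n p) + card (repeated_tuples n p)"
    by (simp add: block_index_def sum.Plus card_block)
  finally show ?thesis
    by (simp add: card_tuples card_psubsets flip: of_nat_power)
qed

lemma prod_list_block:
  "k \<in> block_index n p \<Longrightarrow> is \<in> block k \<Longrightarrow> (\<Prod>i\<leftarrow>is. \<sigma> i) = block_spin \<sigma> k"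
  by (auto simp: block_index_def block_def block_spin_def permutations_of_set_def
      prod.distinct_set_conv_list)

lemma hamiltonian_eq_blocks:
  "hamiltonian n p \<beta> 0 G \<sigma> =
    (\<Sum>k\<in>block_index n p. (\<Sum>is\<in>block k. \<beta> / real n powr ((real p - 1) / 2) * G is) * block_spin \<sigma> k)"
proof -
  have "hamiltonian n p \<beta> 0 G \<sigma> =
      (\<Sum>is\<in>tuples n p. \<beta> / real n powr ((real p - 1) / 2) * G is * (\<Prod>i\<leftarrow>is. \<sigma> i))"
    by (simp add: hamiltonian_def sum_distrib_left mult_ac)
  also have "\<dots> = (\<Sum>k\<in>block_index n p. \<Sum>is\<in>block k.
      \<beta> / real n powr ((real p - 1) / 2) * G is * (\<Prod>i\<leftarrow>is. \<sigma> i))"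
    unfolding UN_blocks[symmetric] using disjoint_blocks
    by (intro sum.UNION_disjoint) (auto simp: disjoint_family_on_def)
  also have "\<dots> = (\<Sum>k\<in>block_index n p. \<Sum>is\<in>block k.
      \<beta> / real n powr ((real p - 1) / 2) * G is * block_spin \<sigma> k)"
    by (intro sum.cong refl) (simp add: prod_list_block)
  finally show ?thesis
    by (simp add: sum_distrib_right)
qed

lemma block_spin_cases:
  assumes "\<sigma> \<in> spins n" "k \<in> block_index n p"
  shows "block_spin \<sigma> k = 1 \<or> block_spin \<sigma> k = - 1"
proof -
  have \<sigma>: "\<sigma> i = 1 \<or> \<sigma> i = - 1" if "i \<in> {1..n}" for i
    using assms(1) that by (auto simp: spins_def PiE_def Pi_def)
  have subset: "(\<Prod>i\<in>a. \<sigma> i) = 1 \<or> (\<Prod>i\<in>a. \<sigma> i) = - 1" if "a \<subseteq> {1..n}" for a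
  proof -
    have "finite a" using that by (rule finite_subset) simp
    then show ?thesis using that by (induction a rule: finite_induct) (use \<sigma> in fastforce)+
  qed
  have list: "(\<Prod>i\<leftarrow>is. \<sigma> i) = 1 \<or> (\<Prod>i\<leftarrow>is. \<sigma> i) = - 1" if "set is \<subseteq> {1..n}" for "is"
    using that by (induction "is") (use \<sigma> in fastforce)+
  show ?thesis
  proof (cases k)
    case (Inl a)
    then have "a \<subseteq> {1..n}" using assms(2) by (auto simp: block_index_def psubsets_def)
    from subset[OF this] Inl show ?thesis by (simp add: block_spin_def)
  next
    case (Inr "is")
    then have "set is \<subseteq> {1..n}"
      using assms(2) by (auto simp: block_index_def repeated_tuples_def tuples_def)
    from list[OF this] Inr show ?thesis by (simp add: block_spin_def)
  qed
qed

lemma block_partition_coordinate: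
  assumes "k \<in> block_index n p"
  obtains A B where "0 \<le> A" "0 \<le> B" "0 < A + B"
    "\<And>t. block_partition n p (x(k := t)) = A * exp t + B * exp (- t)"
proof
  define r where "r = (\<lambda>\<sigma>. exp (\<Sum>j\<in>block_index n p - {k}. x j * block_spin \<sigma> j))"
  define A where "A = (\<Sum>\<sigma>\<in>{\<sigma>\<in>spins n. block_spin \<sigma> k = 1}. r \<sigma>)"
  define B where "B = (\<Sum>\<sigma>\<in>{\<sigma>\<in>spins n. block_spin \<sigma> k \<noteq> 1}. r \<sigma>)"
  show "0 \<le> A" "0 \<le> B" by (auto simp: A_def B_def r_def intro: sum_nonneg)
  have split: "(\<Sum>\<sigma>\<in>spins n. g \<sigma>) = (\<Sum>\<sigma>\<in>{\<sigma>\<in>spins n. block_spin \<sigma> k = 1}. g \<sigma>) +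
      (\<Sum>\<sigma>\<in>{\<sigma>\<in>spins n. block_spin \<sigma> k \<noteq> 1}. g \<sigma>)" for g :: "_ \<Rightarrow> real"
    by (subst sum.union_disjoint[symmetric]) (auto intro!: sum.cong)
  have "0 < (\<Sum>\<sigma>\<in>spins n. r \<sigma>)" by (intro sum_pos) (auto simp: r_def)
  then show "0 < A + B" unfolding split[of r] A_def B_def .
  fix t
  have "(\<Sum>j\<in>block_index n p. (x(k := t)) j * block_spin \<sigma> j) =
      t * block_spin \<sigma> k + (\<Sum>j\<in>block_index n p - {k}. x j * block_spin \<sigma> j)" for \<sigma>
    using assms by (subst sum.remove[of _ k]) (auto intro!: sum.cong)
  then have "block_partition n p (x(k := t)) = (\<Sum>\<sigma>\<in>spins n. exp (t * block_spin \<sigma> k) * r \<sigma>)"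
    by (simp add: block_partition_def r_def exp_add)
  also have "\<dots> = (\<Sum>\<sigma>\<in>{\<sigma>\<in>spins n. block_spin \<sigma> k = 1}. exp t * r \<sigma>) +
      (\<Sum>\<sigma>\<in>{\<sigma>\<in>spins n. block_spin \<sigma> k \<noteq> 1}. exp (- t) * r \<sigma>)"
    unfolding split using block_spin_cases[OF _ assms]
    by (intro arg_cong2[where f = "(+)"] sum.cong) (auto, fastforce)
  finally show "block_partition n p (x(k := t)) = A * exp t + B * exp (- t)"
    by (simp add: A_def B_def sum_distrib_left mult.commute)
qed

section \<open>Exchanging couplings for equations\<close>

lemma set_equation_pmf_finite [simp]: "finite (set_pmf (equation_pmf q))"
proof -
  have "set_pmf (equation_pmf q) \<subseteq> {None, Some 0, Some 1}"
    by (auto simp: equation_pmf_def split: if_splits)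
  then show ?thesis by (rule finite_subset) simp
qed

lemma expectation_equation_pmf:
  assumes "0 \<le> q" "q \<le> 1"
  shows "measure_pmf.expectation (equation_pmf q) h =
    (1 - q) * h None + q / 2 * (h (Some 0) + h (Some 1) :: real)"
  using assms unfolding equation_pmf_def
  by (subst pmf_expectation_bind[of UNIV]) (auto simp: UNIV_bool algebra_simps)

lemma prob_equation_included:
  assumes "0 \<le> q" "q \<le> 1"
  shows "measure_pmf.prob (equation_pmf q) (- {None}) = q"
proof -
  have "measure_pmf.prob (equation_pmf q) (- {None}) =
      measure_pmf.expectation (equation_pmf q) (indicator (- {None}))"
    by simp
  also have "\<dots> = q" unfolding expectation_equation_pmf[OF assms] by simp
  finally show ?thesis .
qed

text \<open>
  On the discrete side the blocks of repeated tuples carry the constant \<^const>\<open>None\<close>, so restricting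
  to the other blocks recovers a random instance.
\<close>
lemma map_Pi_pmf_block_index:
  "map_pmf (\<lambda>w. w \<circ> Inl) (Pi_pmf (block_index n p) None
      (case_sum (\<lambda>_. equation_pmf (d * fact (p - 1) / real n ^ (p - 1))) (\<lambda>_. return_pmf None))) =
    random_xorsat n p d"
proof -
  define E where "E = equation_pmf (d * fact (p - 1) / real n ^ (p - 1))"
  have "Pi_pmf (block_index n p) None (case_sum (\<lambda>_. E) (\<lambda>_. return_pmf None)) =
      Pi_pmf (Inl ` psubsets n p) None (case_sum (\<lambda>_. E) (\<lambda>_. return_pmf None))"
    by (rule Pi_pmf_subset') (auto simp: block_index_def)
  also have "\<dots> = Pi_pmf (Inl ` psubsets n p) None (\<lambda>_. E)"
    by (rule Pi_pmf_cong) auto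
  also have "map_pmf (\<lambda>w. w \<circ> Inl) \<dots> = Pi_pmf (psubsets n p) None (\<lambda>_. E)"
    by (rule Pi_pmf_bij_betw[symmetric]) (auto simp: bij_betw_def)
  finally show ?thesis unfolding E_def random_xorsat_def .
qed

lemma measurable_coupling: "length is = p \<Longrightarrow> (\<lambda>G. G is) \<in> borel_measurable (disorder p)"
  using measurable_component_singleton[of "is" "{is. length is = p}" "\<lambda>_. std_normal_distribution"]
  by (simp add: disorder_def)

lemma xor_block_partition:
  "block_partition n p (\<lambda>k\<in>block_index n p. case_sum (\<lambda>_ e. s * eq_sign e) (\<lambda>_ _. 0) k (w k)) =
    xor_partition n p s (w \<circ> Inl)"
  by (simp add: block_partition_def xor_partition_def block_index_def sum.Plus block_spin_def
      sum_distrib_left mult.assoc)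

text \<open>
  The first error term comes from the \<open>p\<close>-subsets, where the first two moments match by the
  hypothesis on the variances and third moments remain. The second comes from the repeated tuples,
  whose coupling is exchanged for \<open>0\<close>; there the variance itself is an error.
\<close>
lemma gaussian_xor_exchange:
  fixes n p :: nat and \<beta> d s c0 :: real
  defines "c \<equiv> \<beta> / real n powr ((real p - 1) / 2)"
    and "q \<equiv> d * fact (p - 1) / real n ^ (p - 1)"
  assumes "2 \<le> p" "1 \<le> n" "0 < \<beta>" "0 \<le> s" "0 \<le> q" "q \<le> 1" and variance: "q * s\<^sup>2 = c\<^sup>2 * fact p"
  shows "\<bar>(\<integral>G. bump (ln (\<Sum>\<sigma>\<in>spins n. exp (hamiltonian n p \<beta> 0 G \<sigma>)) / real n - c0) \<partial>disorder p) -
      measure_pmf.expectation (random_xorsat n p d) (\<lambda>w. bump (ln (xor_partition n p s w) / real n - c0))\<bar>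
    \<le> real (n choose p) * (6 / real n * (2 * (c * sqrt (fact p)) ^ 3 + q * s ^ 3)) +
       real (card (repeated_tuples n p)) * (3 / real n * c\<^sup>2 + 12 / real n * c ^ 3)"
proof -
  define K where "K = block_index n p"
  define Q where "Q = (case_sum (\<lambda>_. equation_pmf q) (\<lambda>_. return_pmf None) :: nat set + nat list \<Rightarrow> _)"
  define u where "u = (case_sum (\<lambda>_ e. s * eq_sign e) (\<lambda>_ _. 0) :: nat set + nat list \<Rightarrow> _)"
  \<comment> \<open>Outside \<open>K\<close> any positive value will do; it makes every \<open>\<mu> k\<close> a probability measure.\<close>
  define \<tau> where "\<tau> = (\<lambda>k. if k \<in> K then c * sqrt (real (card (block k))) else 1)"
  define \<mu> where "\<mu> = (\<lambda>k. density lborel (normal_density 0 (\<tau> k)))"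
  define f where "f = (\<lambda>x. bump (ln (block_partition n p x) / real n - c0))"
  define e where "e = (case_sum (\<lambda>_. 6 / real n * (2 * (c * sqrt (fact p)) ^ 3 + q * s ^ 3))
      (\<lambda>_. 3 / real n * c\<^sup>2 + 12 / real n * c ^ 3) :: nat set + nat list \<Rightarrow> real)"
  have c_pos: "0 < c" using assms by (simp add: c_def)
  have \<tau>_pos: "0 < \<tau> k" for k
    using c_pos block_nonempty[of k n p] by (simp add: \<tau>_def K_def card_gt_0_iff)
  have \<mu>: "prob_space (\<mu> k)" "sets (\<mu> k) = sets borel" for k
    unfolding \<mu>_def by (rule prob_space_normal_density[OF \<tau>_pos]) simp
  have [measurable]: "bump \<in> borel_measurable borel" unfolding bump_def by measurable
  have f_meas: "f \<in> borel_measurable (PiM K (\<lambda>_. borel))"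
    unfolding f_def block_partition_def K_def by measurable
  have f_bound: "\<bar>f x\<bar> \<le> 1" for x by (simp add: f_def bump_le_1)
  have exchange: "\<bar>(\<integral>t. f (x(k := t)) \<partial>\<mu> k) -
      measure_pmf.expectation (Q k) (\<lambda>b. f (x(k := u k b)))\<bar> \<le> e k" if k: "k \<in> K" for k x
  proof -
    obtain A B where AB: "0 \<le> A" "0 \<le> B" "0 < A + B"
      "\<And>t. block_partition n p (x(k := t)) = A * exp t + B * exp (- t)"
      using block_partition_coordinate k unfolding K_def by metis
    define h where "h = (\<lambda>t. f (x(k := t)))"
    have h: "h = (\<lambda>t. bump (ln (A * exp t + B * exp (- t)) / real n - c0))"
      unfolding h_def f_def AB(4) ..
    obtain a b where b: "\<bar>b\<bar> \<le> 3 / real n"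
      and taylor: "\<And>t. \<bar>h t - (h 0 + a * t + b * t\<^sup>2)\<bar> \<le> 6 / real n * \<bar>t\<bar> ^ 3"
      using bump_log_partition_taylor[OF AB(1-3) \<open>1 \<le> n\<close>, of c0] unfolding h by auto
    have gauss: "\<bar>(\<integral>t. h t \<partial>\<mu> k) - (h 0 + b * (\<tau> k)\<^sup>2)\<bar> \<le> 2 * (6 / real n) * (\<tau> k) ^ 3"
      unfolding \<mu>_def
    proof (rule normal_expectation_third_order[OF \<tau>_pos _ _ _ taylor])
      show "h \<in> borel_measurable borel" unfolding h by measurable
      show "\<bar>h t\<bar> \<le> 1" for t by (simp add: h bump_le_1)
    qed simp
    show ?thesis
    proof (cases k)
      case (Inl S)
      with k have "S \<in> psubsets n p" by (auto simp: K_def block_index_def)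
      with k Inl have \<tau>k: "\<tau> k = c * sqrt (fact p)" by (simp add: \<tau>_def card_block)
      have \<tau>2: "(\<tau> k)\<^sup>2 = q * s\<^sup>2"
        using variance by (simp add: \<tau>k power_mult_distrib)
      have "measure_pmf.expectation (Q k) (\<lambda>b. h (u k b)) = (1 - q) * h 0 + q / 2 * (h s + h (- s))"
        using Inl by (simp add: Q_def u_def expectation_equation_pmf[OF \<open>0 \<le> q\<close> \<open>q \<le> 1\<close>] eq_sign_def)
      then have "measure_pmf.expectation (Q k) (\<lambda>b. h (u k b)) - (h 0 + b * (\<tau> k)\<^sup>2) =
          q / 2 * ((h s - (h 0 + a * s + b * s\<^sup>2)) + (h (- s) - (h 0 + a * (- s) + b * (- s)\<^sup>2)))"
        unfolding \<tau>2 by (simp add: algebra_simps)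
      also have "\<bar>\<dots>\<bar> \<le> q / 2 * (6 / real n * s ^ 3 + 6 / real n * s ^ 3)"
        unfolding abs_mult using taylor[of s] taylor[of "- s"] \<open>0 \<le> q\<close> \<open>0 \<le> s\<close>
        by (intro mult_mono order_trans[OF abs_triangle_ineq] add_mono) auto
      finally have "\<bar>(\<integral>t. h t \<partial>\<mu> k) - measure_pmf.expectation (Q k) (\<lambda>b. h (u k b))\<bar>
          \<le> 2 * (6 / real n) * (\<tau> k) ^ 3 + q / 2 * (6 / real n * s ^ 3 + 6 / real n * s ^ 3)"
        using gauss by linarith
      also have "\<dots> = e k"
        unfolding \<tau>k using Inl by (simp add: e_def algebra_simps add_divide_distrib)
      finally show ?thesis by (simp add: h_def)
    next
      case (Inr "is")
      with k have \<tau>k: "\<tau> k = c" by (simp add: \<tau>_def card_block)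
      have "measure_pmf.expectation (Q k) (\<lambda>b. h (u k b)) = h 0"
        using Inr by (simp add: Q_def u_def)
      moreover have "\<bar>b * (\<tau> k)\<^sup>2\<bar> \<le> 3 / real n * c\<^sup>2"
        using mult_right_mono[OF b, of "c\<^sup>2"] by (simp add: \<tau>k abs_mult)
      ultimately have "\<bar>(\<integral>t. h t \<partial>\<mu> k) - measure_pmf.expectation (Q k) (\<lambda>b. h (u k b))\<bar>
          \<le> 3 / real n * c\<^sup>2 + 2 * (6 / real n) * (\<tau> k) ^ 3"
        using gauss by linarith
      then show ?thesis unfolding \<tau>k using Inr by (simp add: e_def h_def)
    qed
  qed
  have "\<bar>(\<integral>x. f x \<partial>PiM K \<mu>) -
      measure_pmf.expectation (Pi_pmf K None Q) (\<lambda>w. f (\<lambda>k\<in>K. u k (w k)))\<bar> \<le> (\<Sum>k\<in>K. e k)"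
  proof (rule lindeberg_exchange[OF _ \<mu> _ f_meas f_bound exchange])
    show "finite K" by (simp add: K_def)
    show "finite (set_pmf (Q k))" for k by (simp add: Q_def split: sum.split)
  qed
  moreover have "(\<Sum>k\<in>K. e k) = real (n choose p) * (6 / real n * (2 * (c * sqrt (fact p)) ^ 3 + q * s ^ 3)) +
       real (card (repeated_tuples n p)) * (3 / real n * c\<^sup>2 + 12 / real n * c ^ 3)"
    by (simp add: K_def block_index_def sum.Plus e_def card_psubsets)
  moreover have "(\<integral>x. f x \<partial>PiM K \<mu>) =
      (\<integral>G. bump (ln (\<Sum>\<sigma>\<in>spins n. exp (hamiltonian n p \<beta> 0 G \<sigma>)) / real n - c0) \<partial>disorder p)"
  proof -
    define X where "X = (\<lambda>G. \<lambda>k\<in>K. \<Sum>is\<in>block k. c * G is)"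
    \<comment> \<open>For \<open>n < p\<close> there are no \<open>p\<close>-subsets, but a constant tuple is always available.\<close>
    have "\<not> distinct (replicate p (1 :: nat))"
      using \<open>2 \<le> p\<close> distinct_card[of "replicate p (1 :: nat)"] by (auto simp: set_replicate_conv_if)
    then have "replicate p 1 \<in> repeated_tuples n p"
      using \<open>2 \<le> p\<close> \<open>1 \<le> n\<close> by (simp add: repeated_tuples_def tuples_def)
    then have "K \<noteq> {}" by (auto simp: K_def block_index_def)
    have block_sub: "block k \<subseteq> {is. length is = p}" if "k \<in> K" for k
      using that UN_blocks[of n p] by (auto simp: K_def tuples_def)
    have "PiM K \<mu> = PiM K (\<lambda>k. density lborel (normal_density 0 (c * sqrt (real (card (block k))))))"
      by (intro PiM_cong refl) (simp add: \<mu>_def \<tau>_def)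
    also have "\<dots> = distr (disorder p) (PiM K (\<lambda>_. borel)) X"
      unfolding X_def disorder_def using \<open>K \<noteq> {}\<close> c_pos block_sub disjoint_blocks block_nonempty
      by (intro distr_disjoint_gaussian_sums[symmetric]) (auto simp: K_def)
    finally have "(\<integral>x. f x \<partial>PiM K \<mu>) = (\<integral>x. f x \<partial>distr (disorder p) (PiM K (\<lambda>_. borel)) X)"
      by simp
    also have "\<dots> = (\<integral>G. f (X G) \<partial>disorder p)"
    proof (rule integral_distr[OF _ f_meas])
      show "X \<in> disorder p \<rightarrow>\<^sub>M PiM K (\<lambda>_. borel)"
        unfolding X_def disorder_def
        by (intro measurable_restrict borel_measurable_sum borel_measurable_times borel_measurable_const
            measurable_coupling[unfolded disorder_def]) (use block_sub in auto)
    qed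
    also have "\<dots> = (\<integral>G. bump (ln (\<Sum>\<sigma>\<in>spins n. exp (hamiltonian n p \<beta> 0 G \<sigma>)) / real n - c0) \<partial>disorder p)"
      unfolding f_def block_partition_def X_def hamiltonian_eq_blocks c_def K_def
      by (simp cong: sum.cong)
    finally show ?thesis .
  qed
  moreover have "measure_pmf.expectation (Pi_pmf K None Q) (\<lambda>w. f (\<lambda>k\<in>K. u k (w k))) =
      measure_pmf.expectation (random_xorsat n p d) (\<lambda>w. bump (ln (xor_partition n p s w) / real n - c0))"
    unfolding map_Pi_pmf_block_index[symmetric] f_def u_def K_def Q_def q_def xor_block_partition
    by simp
  ultimately show ?thesis by simp
qed

section \<open>The optimum and the free energy of XORSAT\<close>

definition num_eqs :: "nat \<Rightarrow> nat \<Rightarrow> xor_instance \<Rightarrow> nat" where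
  "num_eqs n p w = card {a \<in> psubsets n p. w a \<noteq> None}"

definition spin_of :: "nat \<Rightarrow> (nat \<Rightarrow> bit) \<Rightarrow> nat \<Rightarrow> real" where
  "spin_of n x = (\<lambda>i\<in>{1..n}. if x i = 0 then 1 else - 1)"

lemma finite_assignments [simp]: "finite (assignments n)"
proof -
  have "(UNIV :: bit set) \<subseteq> {0, 1}" by auto
  then have "finite (UNIV :: bit set)" by (rule finite_subset) simp
  then show ?thesis unfolding assignments_def by (intro finite_PiE) auto
qed

lemma assignments_nonempty [simp]: "assignments n \<noteq> {}"
  by (simp add: assignments_def PiE_eq_empty_iff)

lemma spins_eq_image: "spins n = spin_of n ` assignments n"
proof
  show "spin_of n ` assignments n \<subseteq> spins n"
    by (auto simp: spins_def spin_of_def split: if_splits)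
  show "spins n \<subseteq> spin_of n ` assignments n"
  proof
    fix \<sigma> assume \<sigma>: "\<sigma> \<in> spins n"
    define x :: "nat \<Rightarrow> bit" where "x = (\<lambda>i\<in>{1..n}. if \<sigma> i = 1 then 0 else 1)"
    have "\<sigma> i = spin_of n x i" for i
      using \<sigma> by (cases "i \<in> {1..n}") (auto simp: spin_of_def spins_def x_def PiE_def Pi_def extensional_def)
    then have "\<sigma> = spin_of n x" by (rule ext)
    moreover have "x \<in> assignments n" by (simp add: assignments_def x_def)
    ultimately show "\<sigma> \<in> spin_of n ` assignments n" by (rule image_eqI)
  qed
qed

lemma prod_spin_of:
  assumes "a \<in> psubsets n p"
  shows "(\<Prod>i\<in>a. spin_of n x i) = (if (\<Sum>i\<in>a. x i) = 0 then 1 else - 1)"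
proof -
  have "finite a" "a \<subseteq> {1..n}"
    using finite_psubset[OF assms] assms unfolding psubsets_def by simp_all
  then show ?thesis
  proof (induction a rule: finite_induct)
    case empty then show ?case by simp
  next
    case (insert i a)
    then show ?case
      by (cases "x i"; cases "\<Sum>i\<in>a. x i") (simp_all add: spin_of_def)
  qed
qed

lemma spin_sum_eq_satisfied:
  "(\<Sum>a\<in>psubsets n p. eq_sign (w a) * (\<Prod>i\<in>a. spin_of n x i)) =
    2 * real (card (satisfied_eqs n p w x)) - real (num_eqs n p w)"
proof -
  have "(\<Sum>a\<in>psubsets n p. eq_sign (w a) * (\<Prod>i\<in>a. spin_of n x i)) =
    (\<Sum>a\<in>psubsets n p. 2 * of_bool (w a = Some (\<Sum>i\<in>a. x i)) - of_bool (w a \<noteq> None))"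
  proof (rule sum.cong[OF refl])
    fix a assume "a \<in> psubsets n p"
    then show "eq_sign (w a) * (\<Prod>i\<in>a. spin_of n x i) =
        2 * of_bool (w a = Some (\<Sum>i\<in>a. x i)) - of_bool (w a \<noteq> None)"
    proof (cases "w a")
      case (Some y)
      then show ?thesis
        by (cases y; cases "\<Sum>i\<in>a. x i") (simp_all add: eq_sign_def prod_spin_of[OF \<open>a \<in> psubsets n p\<close>])
    qed (simp add: eq_sign_def)
  qed
  also have "\<dots> = 2 * (\<Sum>a\<in>psubsets n p. of_bool (w a = Some (\<Sum>i\<in>a. x i))) -
      (\<Sum>a\<in>psubsets n p. of_bool (w a \<noteq> None))"
    unfolding sum_subtractf sum_distrib_left ..
  also have "(\<Sum>a\<in>psubsets n p. of_bool (w a = Some (\<Sum>i\<in>a. x i)) :: real) =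
      real (card (satisfied_eqs n p w x))"
    unfolding satisfied_eqs_def Collect_conj_eq Collect_mem_eq
    by (intro sum_of_bool_eq finite_psubsets)
  also have "(\<Sum>a\<in>psubsets n p. of_bool (w a \<noteq> None) :: real) = real (num_eqs n p w)"
    unfolding num_eqs_def Collect_conj_eq Collect_mem_eq
    by (intro sum_of_bool_eq finite_psubsets)
  finally show ?thesis .
qed

lemma card_satisfied_le_max_sat: "x \<in> assignments n \<Longrightarrow> card (satisfied_eqs n p w x) \<le> max_sat n p w"
  by (simp add: max_sat_def)

lemma max_sat_attained: obtains x where "x \<in> assignments n" "card (satisfied_eqs n p w x) = max_sat n p w"
proof -
  have "max_sat n p w \<in> (\<lambda>x. card (satisfied_eqs n p w x)) ` assignments n"
    unfolding max_sat_def by (rule Max_in) auto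
  then show ?thesis using that by auto
qed

text \<open>
  The usual sandwich of a log-sum-exp by its largest term, with \<open>2 ^ n\<close> terms. By
  \<open>spin_sum_eq_satisfied\<close> the largest exponent is \<open>s\<close> times (satisfied minus violated) at an optimum.
\<close>
lemma xor_partition_bounds:
  fixes n p :: nat and w :: xor_instance and s :: real
  assumes "0 \<le> s"
  defines "T \<equiv> 2 * real (max_sat n p w) - real (num_eqs n p w)"
  shows "s * T \<le> ln (xor_partition n p s w)"
    and "ln (xor_partition n p s w) \<le> real n * ln 2 + s * T"
proof -
  define H where "H = (\<lambda>\<sigma>. \<Sum>a\<in>psubsets n p. eq_sign (w a) * (\<Prod>i\<in>a. \<sigma> i))"
  have Z: "xor_partition n p s w = (\<Sum>\<sigma>\<in>spins n. exp (s * H \<sigma>))"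
    by (simp add: xor_partition_def H_def)
  obtain x where x: "x \<in> assignments n" "card (satisfied_eqs n p w x) = max_sat n p w"
    by (rule max_sat_attained)
  have "H (spin_of n x) = T"
    unfolding H_def spin_sum_eq_satisfied x(2) T_def ..
  then have lower: "exp (s * T) \<le> xor_partition n p s w"
    unfolding Z using x(1) member_le_sum[of "spin_of n x" "spins n" "\<lambda>\<sigma>. exp (s * H \<sigma>)"]
    by (auto simp: spins_eq_image)
  have "H \<sigma> \<le> T" if "\<sigma> \<in> spins n" for \<sigma>
    using that card_satisfied_le_max_sat[of _ n p w]
    unfolding spins_eq_image H_def T_def by (auto simp: spin_sum_eq_satisfied)
  then have "xor_partition n p s w \<le> real (card (spins n)) * exp (s * T)"
    unfolding Z using \<open>0 \<le> s\<close> by (intro sum_bounded_above) (auto intro: mult_left_mono)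
  also have "card (spins n) = 2 ^ n"
    by (simp add: spins_def card_PiE numeral_2_eq_2)
  finally have upper: "xor_partition n p s w \<le> 2 ^ n * exp (s * T)" by simp
  have pos: "0 < xor_partition n p s w"
    using lower exp_gt_zero[of "s * T"] by linarith
  show "s * T \<le> ln (xor_partition n p s w)"
    using lower pos by (simp add: ln_ge_iff)
  have "ln (xor_partition n p s w) \<le> ln (2 ^ n * exp (s * T))"
    using upper pos by (simp add: ln_le_cancel_iff)
  also have "\<dots> = real n * ln 2 + s * T"
    by (simp add: ln_mult ln_realpow)
  finally show "ln (xor_partition n p s w) \<le> real n * ln 2 + s * T" .
qed

section \<open>Concentration of the optimum\<close>

lemma max_sat_remove_equation:
  "\<bar>real (max_sat n p w) - real (max_sat n p (w(a := None)))\<bar> \<le> 1"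
proof -
  define w' where "w' = w(a := None)"
  have sub: "satisfied_eqs n p w' x \<subseteq> satisfied_eqs n p w x"
    and sup: "satisfied_eqs n p w x \<subseteq> insert a (satisfied_eqs n p w' x)" for x
    by (auto simp: satisfied_eqs_def w'_def)
  have fin: "finite (satisfied_eqs n p v x)" for v x
    by (simp add: satisfied_eqs_def)
  have le: "card (satisfied_eqs n p w' x) \<le> card (satisfied_eqs n p w x)" for x
    using card_mono[OF fin sub] .
  have ge: "card (satisfied_eqs n p w x) \<le> card (satisfied_eqs n p w' x) + 1" for x
  proof -
    have "card (satisfied_eqs n p w x) \<le> card (insert a (satisfied_eqs n p w' x))"
      using fin by (intro card_mono sup) simp
    also have "\<dots> \<le> card (satisfied_eqs n p w' x) + 1"
      by (simp add: card_insert_if fin)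
    finally show ?thesis .
  qed
  obtain x where x: "x \<in> assignments n" "card (satisfied_eqs n p w x) = max_sat n p w"
    by (rule max_sat_attained)
  obtain x' where x': "x' \<in> assignments n" "card (satisfied_eqs n p w' x') = max_sat n p w'"
    by (rule max_sat_attained)
  have "max_sat n p w \<le> max_sat n p w' + 1"
    using x ge[of x] card_satisfied_le_max_sat[OF x(1), of p w'] by linarith
  moreover have "max_sat n p w' \<le> max_sat n p w"
    using x' le[of x'] card_satisfied_le_max_sat[OF x'(1), of p w] by linarith
  ultimately show ?thesis unfolding w'_def[symmetric] by linarith
qed

lemma num_eqs_remove_equation:
  "\<bar>real (num_eqs n p w) - real (num_eqs n p (w(a := None)))\<bar> \<le> 1"
proof -
  define S where "S = {a \<in> psubsets n p. w a \<noteq> None}"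
  have "{b \<in> psubsets n p. (w(a := None)) b \<noteq> None} = S - {a}"
    by (auto simp: S_def)
  moreover have "finite S" by (simp add: S_def)
  ultimately show ?thesis
    unfolding num_eqs_def S_def[symmetric] by (auto simp: card_Diff_singleton_if of_nat_diff)
qed

text \<open>
  Chebyshev's inequality with the Efron--Stein bound. As \<open>(n choose p) q\<close> is linear in \<open>n\<close>, the
  right-hand side is of order \<open>1 / n\<close>.
\<close>
lemma xorsat_concentration:
  fixes f :: "xor_instance \<Rightarrow> real" and n p :: nat and d :: real
  defines "q \<equiv> d * fact (p - 1) / real n ^ (p - 1)"
  assumes "0 \<le> q" "q \<le> 1" "0 < n" "0 < \<delta>"
    and lip: "\<And>w a. \<bar>f w - f (w(a := None))\<bar> \<le> 1"
  shows "measure_pmf.prob (random_xorsat n p d)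
      {w. \<delta> \<le> \<bar>f w / real n - measure_pmf.expectation (random_xorsat n p d) f / real n\<bar>}
    \<le> real (n choose p) * q / (\<delta> * real n)\<^sup>2"
proof -
  define X where "X = random_xorsat n p d"
  have X: "X = Pi_pmf (psubsets n p) None (\<lambda>_. equation_pmf q)"
    by (simp add: X_def random_xorsat_def q_def)
  have fin: "finite (set_pmf X)" unfolding X by (intro finite_set_Pi_pmf) auto
  have "{w. \<delta> \<le> \<bar>f w / real n - measure_pmf.expectation X f / real n\<bar>} =
      {w \<in> space (measure_pmf X). \<delta> * real n \<le> \<bar>f w - measure_pmf.expectation X f\<bar>}"
    using \<open>0 < n\<close> by (simp add: diff_divide_distrib[symmetric] abs_divide pos_le_divide_eq)
  then have "measure_pmf.prob X {w. \<delta> \<le> \<bar>f w / real n - measure_pmf.expectation X f / real n\<bar>}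
      \<le> measure_pmf.variance X f / (\<delta> * real n)\<^sup>2"
    using measure_pmf.Chebyshev_inequality[of f X "\<delta> * real n"] assms fin
    by (simp add: integrable_measure_pmf_finite)
  also have "measure_pmf.variance X f \<le> real (card (psubsets n p)) * q * 1\<^sup>2"
    unfolding X using assms(2,3) lip
    by (intro efron_stein_default) (auto simp: prob_equation_included)
  finally show ?thesis
    by (simp add: X_def card_psubsets divide_right_mono)
qed

lemma expectation_num_eqs:
  fixes n p :: nat and d :: real
  defines "q \<equiv> d * fact (p - 1) / real n ^ (p - 1)"
  assumes "0 \<le> q" "q \<le> 1"
  shows "measure_pmf.expectation (random_xorsat n p d) (\<lambda>w. real (num_eqs n p w)) = real (n choose p) * q"
proof -
  define X where "X = random_xorsat n p d"
  have X: "X = Pi_pmf (psubsets n p) None (\<lambda>_. equation_pmf q)"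
    by (simp add: X_def random_xorsat_def q_def)
  have fin: "finite (set_pmf X)" unfolding X by (intro finite_set_Pi_pmf) auto
  have "real (num_eqs n p w) = (\<Sum>a\<in>psubsets n p. indicator (- {None}) (w a))" for w
    by (simp add: num_eqs_def indicator_def sum.If_cases Int_def)
  then have "measure_pmf.expectation X (\<lambda>w. real (num_eqs n p w)) =
      (\<Sum>a\<in>psubsets n p. measure_pmf.expectation X (\<lambda>w. indicator (- {None}) (w a)))"
    using fin by (simp add: integrable_measure_pmf_finite)
  also have "\<dots> = (\<Sum>a\<in>psubsets n p. q)"
  proof (rule sum.cong[OF refl])
    fix a assume a: "a \<in> psubsets n p"
    have "measure_pmf.expectation X (\<lambda>w. indicator (- {None}) (w a)) =
        measure_pmf.expectation (map_pmf (\<lambda>w. w a) X) (indicator (- {None}) :: _ \<Rightarrow> real)"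
      by (rule integral_map_pmf[symmetric])
    also have "map_pmf (\<lambda>w. w a) X = equation_pmf q"
      unfolding X using a by (simp add: Pi_pmf_component)
    also have "measure_pmf.expectation (equation_pmf q) (indicator (- {None}) :: _ \<Rightarrow> real) = q"
      using prob_equation_included[OF assms(2,3)] by simp
    finally show "measure_pmf.expectation X (\<lambda>w. indicator (- {None}) (w a)) = q" .
  qed
  finally show ?thesis by (simp add: X_def card_psubsets)
qed

section \<open>Limits in the number of variables\<close>

lemma choose_div_power_tendsto:
  "(\<lambda>n. real (n choose p) / real n ^ p) \<longlonglongrightarrow> 1 / fact p"
proof -
  have "(\<lambda>n. (\<Prod>i<p. (real n - real i) / real n) / fact p) \<longlonglongrightarrow> (\<Prod>i<p. 1) / fact p"
  proof (intro tendsto_divide tendsto_prod tendsto_const)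
    fix i :: nat
    show "(\<lambda>n. (real n - real i) / real n) \<longlonglongrightarrow> 1" by real_asymp
  qed simp
  moreover have "(\<Prod>i<p. (real n - real i) / real n) / fact p = real (n choose p) / real n ^ p" for n
    by (simp add: binomial_gbinomial gbinomial_prod_rev prod_dividef atLeast0LessThan)
  ultimately show ?thesis by simp
qed

lemma repeated_tuples_negligible:
  "(\<lambda>n. real (card (repeated_tuples n p)) / real n ^ p) \<longlonglongrightarrow> 0"
proof -
  have "(\<lambda>n. 1 - fact p * (real (n choose p) / real n ^ p)) \<longlonglongrightarrow> 1 - fact p * (1 / fact p)"
    by (intro tendsto_intros choose_div_power_tendsto)
  moreover have "\<forall>\<^sub>F n in sequentially. 1 - fact p * (real (n choose p) / real n ^ p) =
      real (card (repeated_tuples n p)) / real n ^ p"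
    using eventually_gt_at_top[of 0]
    by eventually_elim (simp add: card_repeated_tuples diff_divide_distrib)
  ultimately show ?thesis by (simp add: tendsto_cong)
qed

lemma gaussian_bump_tendsto:
  assumes "is_free_energy p \<beta> 0 F"
  shows "(\<lambda>n. \<integral>G. bump (ln (\<Sum>\<sigma>\<in>spins n. exp (hamiltonian n p \<beta> 0 G \<sigma>)) / real n - F) \<partial>disorder p)
    \<longlonglongrightarrow> 1"
proof -
  define L where "L = (\<lambda>n G. ln (\<Sum>\<sigma>\<in>spins n. exp (hamiltonian n p \<beta> 0 G \<sigma>)) / real n)"
  interpret prob_space "disorder p"
    unfolding disorder_def by (intro prob_space_PiM prob_space_normal_density) simp
  have [measurable]: "bump \<in> borel_measurable borel" unfolding bump_def by measurable
  have [measurable]: "(\<lambda>G. G is) \<in> borel_measurable (disorder p)" if "is \<in> tuples n p" for "is" n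
    using that by (intro measurable_coupling) (simp add: tuples_def)
  have [measurable]: "(\<lambda>G. hamiltonian n p \<beta> 0 G \<sigma>) \<in> borel_measurable (disorder p)" for n \<sigma>
    unfolding hamiltonian_def by measurable
  have [measurable]: "L n \<in> borel_measurable (disorder p)" for n
    unfolding L_def by measurable
  have "isCont bump 0"
    unfolding bump_def by (intro continuous_intros) auto
  have "(\<lambda>n. \<integral>G. bump (L n G - F) \<partial>disorder p) \<longlonglongrightarrow> (\<integral>G. bump 0 \<partial>disorder p)"
  proof (rule integral_dominated_convergence[where w = "\<lambda>_. 1"])
    show "AE G in disorder p. (\<lambda>n. bump (L n G - F)) \<longlonglongrightarrow> bump 0"
      using assms unfolding is_free_energy_def
    proof eventually_elim
      case (elim G)
      then have "(\<lambda>n. L n G) \<longlonglongrightarrow> F" by (simp add: L_def)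
      then have "(\<lambda>n. L n G - F) \<longlonglongrightarrow> 0" using LIM_zero by blast
      then show ?case by (rule isCont_tendsto_compose[OF \<open>isCont bump 0\<close>])
    qed
    show "AE G in disorder p. norm (bump (L n G - F)) \<le> 1" for n
      by (simp add: bump_le_1)
  qed auto
  then show ?thesis by (simp add: L_def prob_space bump_def)
qed

lemma inclusion_prob_tendsto_0:
  assumes "2 \<le> p"
  shows "(\<lambda>n. d * fact (p - 1) / real n ^ (p - 1)) \<longlonglongrightarrow> 0"
  using assms
  by (intro tendsto_divide_0[OF tendsto_const] filterlim_at_top_imp_at_infinity
      filterlim_pow_at_top filterlim_real_sequentially) simp

lemma expected_equations_tendsto:
  assumes "2 \<le> p"
  shows "(\<lambda>n. real (n choose p) * (d * fact (p - 1) / real n ^ (p - 1)) / real n) \<longlonglongrightarrow> d / real p"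
proof -
  have p: "fact p = real p * fact (p - 1)" "Suc (p - 1) = p" using assms by (auto simp: fact_reduce)
  have "(\<lambda>n. d * fact (p - 1) * (real (n choose p) / real n ^ p)) \<longlonglongrightarrow> d * fact (p - 1) * (1 / fact p)"
    by (intro tendsto_intros choose_div_power_tendsto)
  also have "d * fact (p - 1) * (1 / fact p) = d / real p" by (simp add: p(1))
  also have "(\<lambda>n. d * fact (p - 1) * (real (n choose p) / real n ^ p)) =
      (\<lambda>n. real (n choose p) * (d * fact (p - 1) / real n ^ (p - 1)) / real n)"
    using p(2) power_Suc2[of "real _" "p - 1"] by (intro ext) simp
  finally show ?thesis .
qed

lemma coupling_scale_squared:
  assumes "0 < n" "1 \<le> p"
  shows "(\<beta> / real n powr ((real p - 1) / 2))\<^sup>2 = \<beta>\<^sup>2 / real n ^ (p - 1)"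
proof -
  have "(real n powr ((real p - 1) / 2))\<^sup>2 = real n powr real (p - 1)"
    using assms by (simp add: power2_eq_square powr_add[symmetric] of_nat_diff)
  also have "\<dots> = real n ^ (p - 1)" using assms by (intro powr_realpow) simp
  finally show ?thesis by (simp add: power_divide)
qed

text \<open>
  Since \<open>c n ^ 2 = \<beta>\<^sup>2 / n ^ (p - 1)\<close>, dividing by \<open>n\<close> leaves the densities of \<open>p\<close>-subsets and of
  repeated tuples among all \<open>n ^ p\<close> tuples. The first density stays positive but each Gaussian third
  moment carries a further factor \<open>c n\<close>; the second density vanishes. Only the third moments of the
  sparse signs survive.
\<close>
lemma exchange_error_tendsto:
  fixes p :: nat and \<beta> d s :: real
  assumes "2 \<le> p" "0 < \<beta>"
  defines "c \<equiv> \<lambda>n. \<beta> / real n powr ((real p - 1) / 2)"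
    and "q \<equiv> \<lambda>n. d * fact (p - 1) / real n ^ (p - 1)"
  shows "(\<lambda>n. real (n choose p) * (6 / real n * (2 * (c n * sqrt (fact p)) ^ 3 + q n * s ^ 3)) +
      real (card (repeated_tuples n p)) * (3 / real n * (c n)\<^sup>2 + 12 / real n * c n ^ 3))
    \<longlonglongrightarrow> 6 * (d / real p) * s ^ 3"
proof -
  have "0 < (real p - 1) / 2" using assms(1) by simp
  then have "filterlim (\<lambda>n. real n powr ((real p - 1) / 2)) at_top sequentially"
    by real_asymp
  then have c_lim: "c \<longlonglongrightarrow> 0"
    unfolding c_def by (intro tendsto_divide_0[OF tendsto_const] filterlim_at_top_imp_at_infinity)
  have "(\<lambda>n. real (n choose p) / real n ^ p * (12 * \<beta>\<^sup>2 * (fact p * sqrt (fact p)) * c n) +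
      6 * (real (n choose p) * q n / real n) * s ^ 3 +
      real (card (repeated_tuples n p)) / real n ^ p * (3 * \<beta>\<^sup>2 + 12 * \<beta>\<^sup>2 * c n))
    \<longlonglongrightarrow> 1 / fact p * (12 * \<beta>\<^sup>2 * (fact p * sqrt (fact p)) * 0) + 6 * (d / real p) * s ^ 3 +
      0 * (3 * \<beta>\<^sup>2 + 12 * \<beta>\<^sup>2 * 0)"
    unfolding q_def
    by (intro tendsto_intros choose_div_power_tendsto c_lim expected_equations_tendsto
        repeated_tuples_negligible assms(1))
  moreover have "\<forall>\<^sub>F n in sequentially.
      real (n choose p) / real n ^ p * (12 * \<beta>\<^sup>2 * (fact p * sqrt (fact p)) * c n) +
      6 * (real (n choose p) * q n / real n) * s ^ 3 +
      real (card (repeated_tuples n p)) / real n ^ p * (3 * \<beta>\<^sup>2 + 12 * \<beta>\<^sup>2 * c n) =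
      real (n choose p) * (6 / real n * (2 * (c n * sqrt (fact p)) ^ 3 + q n * s ^ 3)) +
      real (card (repeated_tuples n p)) * (3 / real n * (c n)\<^sup>2 + 12 / real n * c n ^ 3)"
    using eventually_gt_at_top[of 0]
  proof eventually_elim
    case (elim n)
    have c2: "(c n)\<^sup>2 = \<beta>\<^sup>2 / real n ^ (p - 1)"
      unfolding c_def using elim assms(1) by (intro coupling_scale_squared) auto
    have np: "real n ^ p = real n ^ (p - 1) * real n"
      using assms(1) power_Suc2[of "real n" "p - 1"] by simp
    have \<beta>2: "\<beta>\<^sup>2 / real n ^ p = (c n)\<^sup>2 / real n"
      using elim by (simp add: c2 np)
    have c3: "(c n * sqrt (fact p)) ^ 3 = (c n)\<^sup>2 * c n * (fact p * sqrt (fact p))"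
      by (simp add: power_mult_distrib power3_eq_cube power2_eq_square)
    have "real (n choose p) / real n ^ p * (12 * \<beta>\<^sup>2 * (fact p * sqrt (fact p)) * c n) =
        real (n choose p) * 12 * (fact p * sqrt (fact p)) * c n * (\<beta>\<^sup>2 / real n ^ p)"
      by simp
    also have "\<dots> = real (n choose p) * 12 * (fact p * sqrt (fact p)) * c n * ((c n)\<^sup>2 / real n)"
      by (simp only: \<beta>2)
    finally have distinct_part: "real (n choose p) / real n ^ p * (12 * \<beta>\<^sup>2 * (fact p * sqrt (fact p)) * c n) =
        real (n choose p) * 12 * (fact p * sqrt (fact p)) * c n * ((c n)\<^sup>2 / real n)" .
    have "real (card (repeated_tuples n p)) / real n ^ p * (3 * \<beta>\<^sup>2 + 12 * \<beta>\<^sup>2 * c n) =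
        real (card (repeated_tuples n p)) * (3 + 12 * c n) * (\<beta>\<^sup>2 / real n ^ p)"
      by (simp add: algebra_simps)
    also have "\<dots> = real (card (repeated_tuples n p)) * (3 + 12 * c n) * ((c n)\<^sup>2 / real n)"
      by (simp only: \<beta>2)
    finally have repeated_part: "real (card (repeated_tuples n p)) / real n ^ p * (3 * \<beta>\<^sup>2 + 12 * \<beta>\<^sup>2 * c n) =
        real (card (repeated_tuples n p)) * (3 + 12 * c n) * ((c n)\<^sup>2 / real n)" .
    show ?case
      unfolding distinct_part repeated_part c3 using elim
      by (simp add: field_simps power2_eq_square power3_eq_cube)
  qed
  ultimately show ?thesis by (simp add: tendsto_cong)
qed

text \<open>
  The exchange gives an event of probability more than \<open>1 / 2\<close> on which the free energy is within \<open>1\<close> of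
  \<open>F\<close>. For large \<open>n\<close> it meets the events, of probability close to \<open>1\<close>, on which the number of equations
  and the optimum are close to their means. A single instance in the intersection locates the mean of
  the optimum, and concentration carries this back to almost all instances.
\<close>
lemma max_sat_whp:
  fixes p :: nat and \<beta> d F :: real
  defines "s \<equiv> \<beta> * sqrt (real p / d)"
  assumes "2 \<le> p" "0 < \<beta>" "0 < d" and F: "is_free_energy p \<beta> 0 F"
    and small: "6 * (d / real p) * s ^ 3 < 1 / 4"
  shows "(\<lambda>n. measure_pmf.prob (random_xorsat n p d)
    {w. \<bar>real (max_sat n p w) / real n - (d / real p + F / s) / 2\<bar> \<le> 1 / s + 3 / 2}) \<longlonglongrightarrow> 1"
proof -
  define X where "X = (\<lambda>n. random_xorsat n p d)"
  define q where "q = (\<lambda>n::nat. d * fact (p - 1) / real n ^ (p - 1))"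
  define S where "S = (\<lambda>n w. real (max_sat n p w))"
  define N where "N = (\<lambda>n w. real (num_eqs n p w))"
  define L where "L = (\<lambda>n w. ln (xor_partition n p s w) / real n)"
  define ES where "ES = (\<lambda>n. measure_pmf.expectation (X n) (S n) / real n)"
  define EN where "EN = (\<lambda>n. measure_pmf.expectation (X n) (N n) / real n)"
  define Eb where "Eb = (\<lambda>n. measure_pmf.expectation (X n) (\<lambda>w. bump (L n w - F)))"
  define A where "A = (\<lambda>n. {w. 1 < \<bar>L n w - F\<bar>})"
  define B where "B = (\<lambda>n. {w. 1 / 2 \<le> \<bar>N n w / real n - EN n\<bar>})"
  define C where "C = (\<lambda>n. {w. 1 / 2 \<le> \<bar>S n w / real n - ES n\<bar>})"
  have s_pos: "0 < s" using assms by (simp add: s_def)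
  have q_nonneg: "0 \<le> q n" for n using \<open>0 < d\<close> by (simp add: q_def)
  have q_le: "\<forall>\<^sub>F n in sequentially. q n \<le> 1"
    using order_tendstoD(2)[OF inclusion_prob_tendsto_0[OF \<open>2 \<le> p\<close>, of d], of 1]
    by (auto simp: q_def elim: eventually_mono)
  have fin: "finite (set_pmf (X n))" for n
    unfolding X_def random_xorsat_def by (intro finite_set_Pi_pmf) auto
  have Cq: "(\<lambda>n. real (n choose p) * q n / real n) \<longlonglongrightarrow> d / real p"
    unfolding q_def by (rule expected_equations_tendsto[OF \<open>2 \<le> p\<close>])
  have conc: "(\<lambda>n. measure_pmf.prob (X n)
      {w. 1 / 2 \<le> \<bar>f n w / real n - measure_pmf.expectation (X n) (f n) / real n\<bar>}) \<longlonglongrightarrow> 0"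
    if "\<And>n w a. \<bar>f n w - f n (w(a := None))\<bar> \<le> 1" for f :: "nat \<Rightarrow> xor_instance \<Rightarrow> real"
  proof (rule tendsto_sandwich[where f = "\<lambda>_. 0" and h = "\<lambda>n. real (n choose p) * q n / real n * (4 / real n)"])
    have "(\<lambda>n. real (n choose p) * q n / real n * (4 / real n)) \<longlonglongrightarrow> d / real p * 0"
      by (intro tendsto_mult Cq) real_asymp
    then show "(\<lambda>n. real (n choose p) * q n / real n * (4 / real n)) \<longlonglongrightarrow> 0" by simp
    show "\<forall>\<^sub>F n in sequentially. measure_pmf.prob (X n)
        {w. 1 / 2 \<le> \<bar>f n w / real n - measure_pmf.expectation (X n) (f n) / real n\<bar>}
      \<le> real (n choose p) * q n / real n * (4 / real n)"
      using q_le eventually_gt_at_top[of 0]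
    proof eventually_elim
      case (elim n)
      show ?case
        using xorsat_concentration[of d p n "1 / 2" "f n"] that elim q_nonneg[of n]
        by (simp add: X_def q_def power2_eq_square)
    qed
  qed auto
  have B: "(\<lambda>n. measure_pmf.prob (X n) (B n)) \<longlonglongrightarrow> 0"
    unfolding B_def EN_def by (rule conc) (simp add: N_def num_eqs_remove_equation)
  have C: "(\<lambda>n. measure_pmf.prob (X n) (C n)) \<longlonglongrightarrow> 0"
    unfolding C_def ES_def by (rule conc) (simp add: S_def max_sat_remove_equation)
  have "\<forall>\<^sub>F n in sequentially. EN n = real (n choose p) * q n / real n"
    using q_le
  proof eventually_elim
    case (elim n)
    then show ?case
      using expectation_num_eqs[of d p n] q_nonneg[of n] by (simp add: EN_def N_def X_def q_def)
  qed
  then have "EN \<longlonglongrightarrow> d / real p"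
    using Cq by (simp add: tendsto_cong)
  from tendstoD[OF this, of "1 / 2"]
  have EN: "\<forall>\<^sub>F n in sequentially. \<bar>EN n - d / real p\<bar> < 1 / 2"
    by (simp add: dist_real_def)
  \<comment> \<open>The threshold is where \<open>bump \<le> 1 / 2\<close> on \<open>A n\<close> forces the probability of \<open>A n\<close> below \<open>1 / 2\<close>.\<close>
  have "\<forall>\<^sub>F n in sequentially. 3 / 4 < Eb n"
  proof -
    define E where "E = (\<lambda>n. \<integral>G. bump (ln (\<Sum>\<sigma>\<in>spins n. exp (hamiltonian n p \<beta> 0 G \<sigma>)) / real n - F) \<partial>disorder p)"
    define c where "c = (\<lambda>n. \<beta> / real n powr ((real p - 1) / 2))"
    define err where "err = (\<lambda>n. real (n choose p) * (6 / real n * (2 * (c n * sqrt (fact p)) ^ 3 + q n * s ^ 3)) +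
      real (card (repeated_tuples n p)) * (3 / real n * (c n)\<^sup>2 + 12 / real n * c n ^ 3))"
    have "err \<longlonglongrightarrow> 6 * (d / real p) * s ^ 3"
      unfolding err_def c_def q_def by (rule exchange_error_tendsto) fact+
    then have "(\<lambda>n. E n - err n) \<longlonglongrightarrow> 1 - 6 * (d / real p) * s ^ 3"
      unfolding E_def by (intro tendsto_diff gaussian_bump_tendsto F)
    then have "\<forall>\<^sub>F n in sequentially. 3 / 4 < E n - err n"
      by (rule order_tendstoD(1)) (use small in simp)
    then show ?thesis
      using q_le eventually_gt_at_top[of 0]
    proof eventually_elim
      case (elim n)
      have "q n * s\<^sup>2 = (c n)\<^sup>2 * fact p"
      proof -
        have "fact p = real p * fact (p - 1)" using \<open>2 \<le> p\<close> by (simp add: fact_reduce)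
        moreover have "(c n)\<^sup>2 = \<beta>\<^sup>2 / real n ^ (p - 1)"
          unfolding c_def using elim \<open>2 \<le> p\<close> by (intro coupling_scale_squared) auto
        ultimately show ?thesis
          using \<open>0 < d\<close> by (simp add: q_def s_def power_mult_distrib)
      qed
      then have "\<bar>E n - Eb n\<bar> \<le> err n"
        using gaussian_xor_exchange[of p n \<beta> s d F] elim q_nonneg[of n] s_pos assms(2,3)
        unfolding E_def Eb_def err_def c_def q_def X_def L_def by simp
      with elim show ?case by linarith
    qed
  qed
  then have A: "\<forall>\<^sub>F n in sequentially. measure_pmf.prob (X n) (A n) < 1 / 2"
  proof eventually_elim
    case (elim n)
    have "bump (L n w - F) \<le> 1 - indicator (A n) w / 2" for w
      using bump_le_half[of "L n w - F"] bump_le_1[of "L n w - F"]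
      by (cases "w \<in> A n") (simp_all add: A_def)
    then have "Eb n \<le> measure_pmf.expectation (X n) (\<lambda>w. 1 - indicator (A n) w / 2)"
      unfolding Eb_def by (intro integral_mono integrable_measure_pmf_finite fin)
    also have "\<dots> = 1 - measure_pmf.prob (X n) (A n) / 2"
      using fin by (simp add: integrable_measure_pmf_finite)
    finally show ?case using elim by linarith
  qed
  have BC: "\<forall>\<^sub>F n in sequentially. measure_pmf.prob (X n) (B n) < 1 / 4"
      "\<forall>\<^sub>F n in sequentially. measure_pmf.prob (X n) (C n) < 1 / 4"
    by (rule order_tendstoD(2)[OF B], simp) (rule order_tendstoD(2)[OF C], simp)
  have "\<forall>\<^sub>F n in sequentially. \<bar>ES n - (d / real p + F / s) / 2\<bar> \<le> 1 / s + 1"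
    using A EN BC eventually_gt_at_top[of 0]
  proof eventually_elim
    case (elim n)
    have "measure_pmf.prob (X n) (A n \<union> B n \<union> C n) \<le>
        measure_pmf.prob (X n) (A n) + measure_pmf.prob (X n) (B n) + measure_pmf.prob (X n) (C n)"
      using measure_Un_le[of "A n \<union> B n" "X n" "C n"] measure_Un_le[of "A n" "X n" "B n"] by simp
    also have "\<dots> < 1" using elim by simp
    finally have "A n \<union> B n \<union> C n \<noteq> UNIV"
      using measure_pmf.prob_space[of "X n"] by auto
    then obtain w where w: "w \<notin> A n" "w \<notin> B n" "w \<notin> C n" by auto
    define T where "T = (2 * S n w - N n w) / real n"
    have "s * T \<le> L n w" "L n w \<le> ln 2 + s * T"
      using divide_right_mono[OF xor_partition_bounds(1)[of s n p w], of "real n"]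
        divide_right_mono[OF xor_partition_bounds(2)[of s n p w], of "real n"] s_pos elim
      by (simp_all add: T_def S_def N_def L_def add_divide_distrib)
    moreover have "ln 2 \<le> (1 :: real)" using ln_le_minus_one[of 2] by simp
    ultimately have "\<bar>s * T - F\<bar> \<le> 2" using w(1) by (auto simp: A_def)
    then have "\<bar>T - F / s\<bar> \<le> 2 / s"
      using s_pos by (simp add: abs_le_iff field_simps)
    moreover have "S n w / real n = (T + N n w / real n) / 2"
      using elim by (simp add: T_def field_simps)
    ultimately show ?case
      using w(2,3) elim(2) unfolding B_def C_def by (simp add: abs_le_iff) argo
  qed
  then have lower: "\<forall>\<^sub>F n in sequentially. 1 - measure_pmf.prob (X n) (C n) \<le> measure_pmf.prob (X n)
      {w. \<bar>S n w / real n - (d / real p + F / s) / 2\<bar> \<le> 1 / s + 3 / 2}"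
  proof eventually_elim
    case (elim n)
    have "1 - measure_pmf.prob (X n) (C n) = measure_pmf.prob (X n) (- C n)"
      using measure_pmf.prob_compl[of "C n" "X n"] by (simp add: Compl_eq_Diff_UNIV)
    also have "\<dots> \<le> measure_pmf.prob (X n)
        {w. \<bar>S n w / real n - (d / real p + F / s) / 2\<bar> \<le> 1 / s + 3 / 2}"
    proof (rule measure_pmf.finite_measure_mono)
      have "\<bar>S n w / real n - (d / real p + F / s) / 2\<bar> \<le> 1 / s + 3 / 2" if "w \<notin> C n" for w
        using that elim unfolding C_def mem_Collect_eq by linarith
      then show "- C n \<subseteq> {w. \<bar>S n w / real n - (d / real p + F / s) / 2\<bar> \<le> 1 / s + 3 / 2}"
        by auto
    qed simp
    finally show ?case .
  qed
  have lower_lim: "(\<lambda>n. 1 - measure_pmf.prob (X n) (C n)) \<longlonglongrightarrow> 1"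
    using tendsto_diff[OF tendsto_const C, of 1] by simp
  show ?thesis
    using tendsto_sandwich[OF lower _ lower_lim tendsto_const] unfolding X_def S_def by simp
qed

theorem lemma2p1:
  fixes p :: nat and F :: "real \<Rightarrow> real \<Rightarrow> real" and P :: real
  assumes "p \<ge> 2"
    and F: "\<And>\<beta> h. \<beta> > 0 \<Longrightarrow> is_free_energy p \<beta> h (F \<beta> h)"
    and P: "((\<lambda>\<beta>. F \<beta> 0 / \<beta>) \<longlongrightarrow> P) at_top"
  shows "\<exists>(g :: real \<Rightarrow> real) d0. ((\<lambda>d. g d / sqrt d) \<longlongrightarrow> 0) at_top \<and>
    (\<forall>d. d > sat_threshold p \<and> d \<ge> d0 \<longrightarrow>
      (\<lambda>n. measure_pmf.prob (random_xorsat n p d)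
             {\<omega>. \<bar>real (max_sat n p \<omega>) / real n
                   - (d / (2 * real p) + P / 2 * sqrt (d / real p))\<bar> \<le> g d}) \<longlonglongrightarrow> 1)"
proof -
  define \<beta> where "\<beta> = (\<lambda>d::real. d powr (1 / 12))"
  define s where "s = (\<lambda>d. \<beta> d * sqrt (real p / d))"
  define \<gamma> where "\<gamma> = (\<lambda>d. F (\<beta> d) 0 / \<beta> d)"
  \<comment> \<open>The error of \<open>max_sat_whp\<close> at inverse temperature \<open>\<beta> d\<close>, plus the error of \<open>F\<^sub>p(\<beta>, 0) / \<beta>\<close> as a value for \<open>P\<close>.\<close>
  define g where "g = (\<lambda>d. 1 / s d + 3 / 2 + \<bar>\<gamma> d - P\<bar> / 2 * sqrt (d / real p))"
  have p: "0 < real p" using assms(1) by simp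
  have "((\<lambda>d. 6 * (d / real p) * s d ^ 3) \<longlongrightarrow> 0) at_top"
    unfolding s_def \<beta>_def using p by real_asymp
  then have "\<forall>\<^sub>F d in at_top. 6 * (d / real p) * s d ^ 3 < 1 / 4"
    by (rule order_tendstoD) simp
  then obtain d1 where d1: "\<And>d. d1 \<le> d \<Longrightarrow> 6 * (d / real p) * s d ^ 3 < 1 / 4"
    by (auto simp: eventually_at_top_linorder)
  have g_lim: "((\<lambda>d. g d / sqrt d) \<longlongrightarrow> 0) at_top"
  proof -
    have "filterlim \<beta> at_top at_top" unfolding \<beta>_def by real_asymp
    then have "(\<gamma> \<longlongrightarrow> P) at_top"
      unfolding \<gamma>_def by (rule filterlim_compose[OF P])
    then have "((\<lambda>d. \<bar>\<gamma> d - P\<bar> / (2 * sqrt p)) \<longlongrightarrow> \<bar>P - P\<bar> / (2 * sqrt p)) at_top"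
      using p by (intro tendsto_intros) auto
    moreover have "((\<lambda>d. (1 / s d + 3 / 2) / sqrt d) \<longlongrightarrow> 0) at_top"
      unfolding s_def \<beta>_def using p by real_asymp
    ultimately have "((\<lambda>d. (1 / s d + 3 / 2) / sqrt d + \<bar>\<gamma> d - P\<bar> / (2 * sqrt p)) \<longlongrightarrow> 0) at_top"
      using tendsto_add by fastforce
    moreover have "\<forall>\<^sub>F d in at_top. (1 / s d + 3 / 2) / sqrt d + \<bar>\<gamma> d - P\<bar> / (2 * sqrt p) = g d / sqrt d"
      using eventually_gt_at_top[of 0]
      by eventually_elim (simp add: g_def add_divide_distrib real_sqrt_divide)
    ultimately show ?thesis by (simp add: tendsto_cong)
  qed
  have "(\<lambda>n. measure_pmf.prob (random_xorsat n p d)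
             {\<omega>. \<bar>real (max_sat n p \<omega>) / real n
                   - (d / (2 * real p) + P / 2 * sqrt (d / real p))\<bar> \<le> g d}) \<longlonglongrightarrow> 1"
    if "max 1 d1 \<le> d" for d
  proof (rule tendsto_sandwich[where h = "\<lambda>_. 1"])
    have d: "0 < d" "d1 \<le> d" using that by auto
    then have \<beta>: "0 < \<beta> d" by (simp add: \<beta>_def)
    show "(\<lambda>n. measure_pmf.prob (random_xorsat n p d)
        {w. \<bar>real (max_sat n p w) / real n - (d / real p + F (\<beta> d) 0 / s d) / 2\<bar> \<le> 1 / s d + 3 / 2}) \<longlonglongrightarrow> 1"
      unfolding s_def
      by (rule max_sat_whp[OF assms(1) \<beta> d(1) F[OF \<beta>]]) (use d1[OF d(2)] in \<open>simp add: s_def\<close>)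
    have "F (\<beta> d) 0 / s d = \<gamma> d * sqrt (d / real p)"
      using d p by (simp add: s_def \<gamma>_def real_sqrt_divide)
    then have center: "(d / real p + F (\<beta> d) 0 / s d) / 2 - (d / (2 * real p) + P / 2 * sqrt (d / real p)) =
        (\<gamma> d - P) / 2 * sqrt (d / real p)"
      by (simp add: field_simps)
    have "\<bar>(\<gamma> d - P) / 2 * sqrt (d / real p)\<bar> = \<bar>\<gamma> d - P\<bar> / 2 * sqrt (d / real p)"
      using d p by (simp add: abs_mult)
    then have "\<bar>y - (d / (2 * real p) + P / 2 * sqrt (d / real p))\<bar> \<le> g d"
      if "\<bar>y - (d / real p + F (\<beta> d) 0 / s d) / 2\<bar> \<le> 1 / s d + 3 / 2" for y
      using that center unfolding g_def by linarith
    then show "\<forall>\<^sub>F n in sequentially. measure_pmf.prob (random_xorsat n p d)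
        {w. \<bar>real (max_sat n p w) / real n - (d / real p + F (\<beta> d) 0 / s d) / 2\<bar> \<le> 1 / s d + 3 / 2} \<le>
      measure_pmf.prob (random_xorsat n p d)
             {\<omega>. \<bar>real (max_sat n p \<omega>) / real n
                   - (d / (2 * real p) + P / 2 * sqrt (d / real p))\<bar> \<le> g d}"
      by (intro always_eventually allI measure_pmf.finite_measure_mono) auto
  qed auto
  with g_lim show ?thesis by blast
qed

end
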